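(* Let $\alpha,c,\delta>0$ and let $\mathcal A$ be the operator on $\mathbb H_0^0$ described in the context. Then: (a) The residual spectrum is empty: $\sigma_r(\mathcal A)=\emptyset$. (b) The continuous spectrum consists of one single real value: $\sigma_c(\mathcal A)=\left\{-\dfrac{c^2}{\delta}\right\}$. (c) The point spectrum is given by $$\sigma_p(\mathcal A)=\{\lambda\in\mathbb C:\ \alpha\lambda^2+\delta\mu_n\lambda+c^2\mu_n=0,\ n\in\mathbb N\}=\{\lambda_n^0,\lambda_n^1:\ n\in\mathbb N\},$$ where $\operatorname{Re}(\lambda_n^i)<0$ for all $n\in\mathbb N$ and $i=0,1$. Moreover, both branches are eventually real (i.e. $\lambda_n^0,\lambda_n^1\in\mathbb R$ for all sufficiently large $n$), and (for a suitable labelling of the two roots for each $n$) $$\lim_{n\to\infty}\lambda_n^0=-\frac{c^2}{\delta}\quad\text{and}\quad\lim_{n\to\infty}\lambda_n^1=-\infty.$$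
   Context: $A$ is a positive self-adjoint operator with compact resolvent on an infinite-dimensional separable Hilbert space $H$ (for instance $H=L^2(\Omega)$ and $A$ the Dirichlet Laplacian $-\Delta$ on a bounded $C^2$ domain $\Omega$). Its spectrum is $\sigma(A)=\sigma_p(A)=\{\mu_n\}_{n\in\mathbb N}\subset(0,\infty)$ with $\mu_n\to\infty$. The space is $\mathbb H_0^0=\mathcal D(A^{1/2})\times\mathcal D(A^{1/2})$ (complexified, with norm $\|(u,v)\|^2=\|A^{1/2}u\|^2+\|A^{1/2}v\|^2$). The operator is $$\mathcal A(u,v)=\big(v,\ -\alpha^{-1}A(c^2u+\delta v)\big),\qquad \mathcal D(\mathcal A)=\{(u,v)\in\mathbb H_0^0:\ c^2u+\delta v\in\mathcal D(A^{3/2})\}.$$ $\sigma_p,\sigma_c,\sigma_r$ denote the point, continuous and residual spectrum. *)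

theory Defs
  imports "HOL-Analysis.Analysis"
begin

text \<open>Complex inner product spaces, built over the real classes of HOL-Analysis so that norm,
  topology and completeness are those of the library. A complex Hilbert space is a type of sort
  \<open>{complex_inner, complete_space}\<close>. A real Hilbert space with a real operator enters through its
  complexification.\<close>

class scaleC =
  fixes scaleC :: "complex \<Rightarrow> 'a \<Rightarrow> 'a"  (infixr \<open>*\<^sub>C\<close> 75)

class complex_vector = real_vector + scaleC +
  assumes scaleC_add_right: "a *\<^sub>C (x + y) = a *\<^sub>C x + a *\<^sub>C y"
    and scaleC_add_left: "(a + b) *\<^sub>C x = a *\<^sub>C x + b *\<^sub>C x"
    and scaleC_scaleC: "a *\<^sub>C (b *\<^sub>C x) = (a * b) *\<^sub>C x"
    and scaleC_one: "1 *\<^sub>C x = x"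
    and scaleR_scaleC: "r *\<^sub>R x = complex_of_real r *\<^sub>C x"

text \<open>The inner product is linear in the first argument; its real part is the real inner product
  of the library, so that \<open>norm x = sqrt (Re (cinner x x))\<close>.\<close>

class complex_inner = complex_vector + real_inner +
  fixes cinner :: "'a \<Rightarrow> 'a \<Rightarrow> complex"
  assumes cinner_commute: "cinner x y = cnj (cinner y x)"
    and cinner_add_left: "cinner (x + y) z = cinner x z + cinner y z"
    and cinner_scaleC_left: "cinner (a *\<^sub>C x) y = a * cinner x y"
    and Re_cinner: "Re (cinner x y) = inner x y"

instantiation prod :: (complex_vector, complex_vector) complex_vector
begin

definition scaleC_prod_def: "a *\<^sub>C x = (a *\<^sub>C fst x, a *\<^sub>C snd x)"

instance
  by standard
    (simp_all add: scaleC_prod_def scaleC_add_right scaleC_add_left scaleC_scaleC scaleC_one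
      scaleR_prod_def scaleR_scaleC)

end


text \<open>An unbounded operator is a partial map \<open>T\<close>; its domain is \<open>dom T\<close>, its value at
  \<open>x \<in> dom T\<close> is \<open>the (T x)\<close>. Thus equality of operators includes equality of domains, and
  \<open>S \<circ>\<^sub>m T\<close> is the product with its natural domain \<open>{x \<in> D(T). T x \<in> D(S)}\<close>.\<close>

definition linear_op :: "('a::complex_vector \<rightharpoonup> 'b::complex_vector) \<Rightarrow> bool" where
  "linear_op T \<longleftrightarrow> 0 \<in> dom T \<and>
     (\<forall>x\<in>dom T. \<forall>y\<in>dom T. T (x + y) = Some (the (T x) + the (T y))) \<and>
     (\<forall>a. \<forall>x\<in>dom T. T (a *\<^sub>C x) = Some (a *\<^sub>C the (T x)))"

definition densely_defined :: "('a::complex_inner \<rightharpoonup> 'b) \<Rightarrow> bool" where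
  "densely_defined T \<longleftrightarrow> closure (dom T) = UNIV"

text \<open>The Hilbert space adjoint; the vector \<open>w\<close> is unique when \<open>T\<close> is densely defined.\<close>

definition adjoint_op :: "('a::complex_inner \<rightharpoonup> 'a) \<Rightarrow> ('a \<rightharpoonup> 'a)" where
  "adjoint_op T v =
     (if \<exists>w. \<forall>u\<in>dom T. cinner (the (T u)) v = cinner u w
      then Some (THE w. \<forall>u\<in>dom T. cinner (the (T u)) v = cinner u w)
      else None)"

definition self_adjoint :: "('a::complex_inner \<rightharpoonup> 'a) \<Rightarrow> bool" where
  "self_adjoint T \<longleftrightarrow> linear_op T \<and> densely_defined T \<and> adjoint_op T = T"

text \<open>Both notions are meant for self-adjoint \<open>T\<close>, for which \<open>cinner (T u) u\<close> is real.\<close>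

definition nonneg_op :: "('a::complex_inner \<rightharpoonup> 'a) \<Rightarrow> bool" where
  "nonneg_op T \<longleftrightarrow> (\<forall>u\<in>dom T. 0 \<le> Re (cinner (the (T u)) u))"

definition positive_op :: "('a::complex_inner \<rightharpoonup> 'a) \<Rightarrow> bool" where
  "positive_op T \<longleftrightarrow> (\<forall>u\<in>dom T. u \<noteq> 0 \<longrightarrow> 0 < Re (cinner (the (T u)) u))"

text \<open>\<open>T\<^sup>1\<^sup>/\<^sup>2\<close> and \<open>T\<^sup>3\<^sup>/\<^sup>2 = T\<^sup>1\<^sup>/\<^sup>2 T\<close> for a nonnegative self-adjoint \<open>T\<close>; such a \<open>T\<close> has exactly
  one nonnegative self-adjoint square root.\<close>

definition op_sqrt :: "('a::complex_inner \<rightharpoonup> 'a) \<Rightarrow> ('a \<rightharpoonup> 'a)" where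
  "op_sqrt T = (THE S. self_adjoint S \<and> nonneg_op S \<and> S \<circ>\<^sub>m S = T)"

definition op_three_halves :: "('a::complex_inner \<rightharpoonup> 'a) \<Rightarrow> ('a \<rightharpoonup> 'a)" where
  "op_three_halves T = op_sqrt T \<circ>\<^sub>m T"


text \<open>Spectral theory of an operator \<open>T\<close> acting in the normed space with underlying vector
  subspace \<open>X\<close> and norm \<open>N\<close>. The space is passed explicitly because the energy space below is a
  proper subspace of its type and carries a norm different from that of the type.\<close>

definition op_minus :: "('a::complex_vector \<rightharpoonup> 'a) \<Rightarrow> complex \<Rightarrow> 'a \<Rightarrow> 'a" where
  "op_minus T z x = the (T x) - z *\<^sub>C x"

definition resolvent_set ::
    "'a::complex_vector set \<Rightarrow> ('a \<Rightarrow> real) \<Rightarrow> ('a \<rightharpoonup> 'a) \<Rightarrow> complex set" where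
  "resolvent_set X N T =
     {z. bij_betw (op_minus T z) (dom T) X \<and>
         (\<exists>K. \<forall>x\<in>dom T. N x \<le> K * N (op_minus T z x))}"

definition spectrum ::
    "'a::complex_vector set \<Rightarrow> ('a \<Rightarrow> real) \<Rightarrow> ('a \<rightharpoonup> 'a) \<Rightarrow> complex set" where
  "spectrum X N T = - resolvent_set X N T"

definition point_spectrum :: "('a::complex_vector \<rightharpoonup> 'a) \<Rightarrow> complex set" where
  "point_spectrum T = {z. \<exists>x\<in>dom T. x \<noteq> 0 \<and> the (T x) = z *\<^sub>C x}"

definition dense_range ::
    "'a::complex_vector set \<Rightarrow> ('a \<Rightarrow> real) \<Rightarrow> ('a \<rightharpoonup> 'a) \<Rightarrow> complex \<Rightarrow> bool" where
  "dense_range X N T z \<longleftrightarrow> (\<forall>y\<in>X. \<forall>e>0. \<exists>x\<in>dom T. N (op_minus T z x - y) < e)"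

definition continuous_spectrum ::
    "'a::complex_vector set \<Rightarrow> ('a \<Rightarrow> real) \<Rightarrow> ('a \<rightharpoonup> 'a) \<Rightarrow> complex set" where
  "continuous_spectrum X N T =
     {z \<in> spectrum X N T. z \<notin> point_spectrum T \<and> dense_range X N T z}"

definition residual_spectrum ::
    "'a::complex_vector set \<Rightarrow> ('a \<Rightarrow> real) \<Rightarrow> ('a \<rightharpoonup> 'a) \<Rightarrow> complex set" where
  "residual_spectrum X N T =
     {z \<in> spectrum X N T. z \<notin> point_spectrum T \<and> \<not> dense_range X N T z}"

definition compact_map :: "('a::metric_space \<Rightarrow> 'b::metric_space) \<Rightarrow> bool" where
  "compact_map K \<longleftrightarrow> (\<forall>S. bounded S \<longrightarrow> compact (closure (K ` S)))"

definition has_compact_resolvent :: "('a::complex_inner \<rightharpoonup> 'a) \<Rightarrow> bool" where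
  "has_compact_resolvent T \<longleftrightarrow>
     (\<exists>z\<in>resolvent_set UNIV norm T. compact_map (inv_into (dom T) (op_minus T z)))"


definition energy_space :: "('a::complex_inner \<rightharpoonup> 'a) \<Rightarrow> ('a \<times> 'a) set" where
  "energy_space A = dom (op_sqrt A) \<times> dom (op_sqrt A)"

definition energy_norm :: "('a::complex_inner \<rightharpoonup> 'a) \<Rightarrow> 'a \<times> 'a \<Rightarrow> real" where
  "energy_norm A = (\<lambda>(u, v). sqrt ((norm (the (op_sqrt A u)))\<^sup>2 + (norm (the (op_sqrt A v)))\<^sup>2))"

definition damped_wave_op ::
    "real \<Rightarrow> real \<Rightarrow> real \<Rightarrow> ('a::complex_inner \<rightharpoonup> 'a) \<Rightarrow> ('a \<times> 'a \<rightharpoonup> 'a \<times> 'a)" where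
  "damped_wave_op \<alpha> c \<delta> A = (\<lambda>(u, v).
     if (u, v) \<in> energy_space A \<and> c\<^sup>2 *\<^sub>R u + \<delta> *\<^sub>R v \<in> dom (op_three_halves A)
     then Some (v, - ((1 / \<alpha>) *\<^sub>R the (A (c\<^sup>2 *\<^sub>R u + \<delta> *\<^sub>R v))))
     else None)"

end

theory Submission
  imports Defs
begin

text \<open>A self-adjoint positive operator with compact resolvent is diagonal in an orthonormal basis:
  the next eigenvector minimises \<open>\<parallel>A w\<parallel>\<close> over the unit vectors \<open>w\<close> of the domain orthogonal to the
  previous ones. On the \<open>n\<close>-th mode, with eigenvalue \<open>s\<^sub>n\<close>, the equation
  \<open>(\<A> - z) (u, v) = (f, g)\<close> is a \<open>2 \<times> 2\<close> system with determinant \<open>q\<^sub>n(z) / \<alpha>\<close>, where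
  \<open>q\<^sub>n(z) = \<alpha> z\<^sup>2 + \<delta> s\<^sub>n z + c\<^sup>2 s\<^sub>n\<close>. The eigenvalues are the zeros of the \<open>q\<^sub>n\<close>. If no \<open>q\<^sub>n(z)\<close>
  vanishes, then all finite sums of modes lie in the range, so the range is dense. The inverse
  matrices are bounded uniformly in \<open>n\<close> exactly when \<open>q\<^sub>n(z) / s\<^sub>n\<close> stays away from \<open>0\<close>, i.e. when
  \<open>\<delta> z + c\<^sup>2 \<noteq> 0\<close>.\<close>

section \<open>Complex inner products and self-adjoint operators\<close>

text \<open>A compact resolvent yields convergent subsequences only for sequences that are bounded
  together with their images under \<open>A\<close>. This is why the norm of A w is minimised and
  not the quadratic form: a minimising sequence is then bounded in the graph norm. The price is the
  Euler equation A^2 x = s^2 x, from which positivity recovers A x = s x. On mode n both components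
  of the energy space carry the same weight \<open>sqrt (s n)\<close>, so the weight commutes with
  the 2 x 2 systems and unweighted bounds on the entries of the inverse matrices suffice. These
  entries are affine in \<open>s n\<close>, divided by \<open>q n z\<close>. When \<delta> z + c^2 =
  0, \<open>q n z\<close> does not depend on n while one numerator grows like \<open>s n\<close>.
  The construction lists eigenvalues with multiplicity, whereas \<open>\<mu>\<close> is any
  enumeration of their set that tends to infinity; the two are compared only through their
  ranges.\<close>

lemma module_scaleC: "module (scaleC :: complex \<Rightarrow> 'a::complex_vector \<Rightarrow> 'a)"
  by unfold_locales (simp_all add: scaleC_add_right scaleC_add_left scaleC_scaleC scaleC_one)

lemma cinner_zero_left [simp]: "cinner 0 (y::'a::complex_inner) = 0"
  using cinner_add_left[of 0 0 y] by simp

lemma cinner_zero_right [simp]: "cinner (x::'a::complex_inner) 0 = 0"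
  using cinner_commute[of x 0] by simp

lemma cinner_add_right: "cinner (x::'a::complex_inner) (y + z) = cinner x y + cinner x z"
  by (metis cinner_commute cinner_add_left complex_cnj_add)

lemma cinner_scaleC_right: "cinner (x::'a::complex_inner) (a *\<^sub>C y) = cnj a * cinner x y"
  by (metis cinner_commute cinner_scaleC_left complex_cnj_mult)

lemma cinner_minus_left: "cinner (- (x::'a::complex_inner)) y = - cinner x y"
  using cinner_add_left[of x "- x" y] by (simp add: add_eq_0_iff)

lemma cinner_minus_right: "cinner (x::'a::complex_inner) (- y) = - cinner x y"
  using cinner_add_right[of x y "- y"] by (simp add: add_eq_0_iff)

lemma cinner_diff_left: "cinner ((x::'a::complex_inner) - y) z = cinner x z - cinner y z"
  using cinner_add_left[of x "- y" z] by (simp add: cinner_minus_left)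

lemma cinner_diff_right: "cinner (x::'a::complex_inner) (y - z) = cinner x y - cinner x z"
  using cinner_add_right[of x y "- z"] by (simp add: cinner_minus_right)

lemma cinner_scaleR_left: "cinner (r *\<^sub>R (x::'a::complex_inner)) y = of_real r * cinner x y"
  by (simp add: scaleR_scaleC cinner_scaleC_left)

lemma cinner_scaleR_right: "cinner (x::'a::complex_inner) (r *\<^sub>R y) = of_real r * cinner x y"
  by (simp add: scaleR_scaleC cinner_scaleC_right)

lemma cinner_sum_left: "cinner (\<Sum>i\<in>S. f i) (y::'a::complex_inner) = (\<Sum>i\<in>S. cinner (f i) y)"
  by (induction S rule: infinite_finite_induct) (simp_all add: cinner_add_left)

lemmas cinner_linear = cinner_add_left cinner_add_right cinner_scaleC_left cinner_scaleC_right
  cinner_minus_left cinner_minus_right cinner_diff_left cinner_diff_right cinner_scaleR_left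
  cinner_scaleR_right

lemma cinner_self: "cinner x x = complex_of_real ((norm (x::'a::complex_inner))\<^sup>2)"
proof (rule complex_eqI)
  show "Re (cinner x x) = Re (complex_of_real ((norm x)\<^sup>2))"
    by (simp add: Re_cinner power2_norm_eq_inner)
  show "Im (cinner x x) = Im (complex_of_real ((norm x)\<^sup>2))"
    using cinner_commute[of x x] by (simp add: complex_eq_iff)
qed

lemma norm_scaleC: "norm (a *\<^sub>C (x::'a::complex_inner)) = cmod a * norm x"
proof -
  have "complex_of_real ((norm (a *\<^sub>C x))\<^sup>2) = of_real ((cmod a * norm x)\<^sup>2)"
    unfolding cinner_self[symmetric] cinner_scaleC_left cinner_scaleC_right
    by (simp add: cinner_self power_mult_distrib mult_ac flip: complex_norm_square)
  then show ?thesis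
    by (simp del: of_real_power)
qed

lemma cinner_Cauchy_Schwarz: "cmod (cinner x y) \<le> norm (x::'a::complex_inner) * norm y"
proof (cases "cinner x y = 0")
  case False
  \<comment> \<open>A factor of modulus one that rotates the inner product onto the positive axis,
    which leaves the real Cauchy-Schwarz inequality.\<close>
  define a where "a = cnj (sgn (cinner x y))"
  have "a * cinner x y = of_real (cmod (cinner x y))"
    using False complex_norm_square[of "cinner x y"] unfolding a_def
    by (simp add: sgn_eq field_simps power2_eq_square)
  then have "cmod (cinner x y) = Re (cinner (a *\<^sub>C x) y)"
    by (simp add: cinner_scaleC_left)
  also have "\<dots> \<le> norm (a *\<^sub>C x) * norm y"
    by (simp add: Re_cinner norm_cauchy_schwarz)
  also have "\<dots> = norm x * norm y"
    using False by (simp add: norm_scaleC a_def norm_sgn)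
  finally show ?thesis .
qed auto

lemma bounded_linear_cinner_left: "bounded_linear (\<lambda>x. cinner (x::'a::complex_inner) y)"
  by (rule bounded_linear_intro[where K = "norm y"])
    (auto simp: cinner_add_left cinner_scaleR_left scaleR_conv_of_real cinner_Cauchy_Schwarz)

lemma bounded_linear_cinner_right: "bounded_linear (\<lambda>y. cinner (x::'a::complex_inner) y)"
  by (rule bounded_linear_intro[where K = "norm x"])
    (auto simp: cinner_add_right cinner_scaleR_right scaleR_conv_of_real cinner_Cauchy_Schwarz
      mult.commute[of "norm _" "norm x"])

lemmas tendsto_cinner_left = bounded_linear.tendsto[OF bounded_linear_cinner_left]
  and tendsto_cinner_right = bounded_linear.tendsto[OF bounded_linear_cinner_right]

text \<open>The vectors orthogonal to \<open>x\<close> form a closed set; containing a dense set, it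
  contains \<open>x\<close> itself.\<close>

lemma dense_orthogonal_zero:
  fixes x :: "'a::complex_inner"
  assumes "closure D = UNIV" and "\<And>u. u \<in> D \<Longrightarrow> cinner u x = 0"
  shows "x = 0"
proof -
  have "closed {u. cinner u x = 0}"
    by (intro closed_Collect_eq linear_continuous_on bounded_linear_cinner_left continuous_intros)
  then have "closure D \<subseteq> {u. cinner u x = 0}"
    using assms(2) by (intro closure_minimal) auto
  then have "cinner x x = 0"
    using assms(1) by auto
  then show ?thesis
    by (simp add: cinner_self)
qed

section \<open>Linear and self-adjoint operators as partial maps\<close>

lemma linear_op_add:
  "linear_op T \<Longrightarrow> T x = Some x' \<Longrightarrow> T y = Some y' \<Longrightarrow> T (x + y) = Some (x' + y')"
  by (force simp: linear_op_def)

lemma linear_op_scaleC: "linear_op T \<Longrightarrow> T x = Some x' \<Longrightarrow> T (a *\<^sub>C x) = Some (a *\<^sub>C x')"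
  by (force simp: linear_op_def)

lemma linear_op_zero: "linear_op T \<Longrightarrow> T 0 = Some 0"
  using linear_op_scaleC[of T 0 "the (T 0)" 0] by (force simp: linear_op_def)

lemma linear_op_scaleR: "linear_op T \<Longrightarrow> T x = Some x' \<Longrightarrow> T (a *\<^sub>R x) = Some (a *\<^sub>R x')"
  unfolding scaleR_scaleC by (rule linear_op_scaleC)

lemma linear_op_diff:
  "linear_op T \<Longrightarrow> T x = Some x' \<Longrightarrow> T y = Some y' \<Longrightarrow> T (x - y) = Some (x' - y')"
  using linear_op_add[of T x x' "(-1) *\<^sub>R y" "(-1) *\<^sub>R y'"] linear_op_scaleR[of T y y' "-1"] by simp

lemma linear_op_sum:
  assumes "linear_op T" and "\<And>i. i \<in> S \<Longrightarrow> T (f i) = Some (g i)"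
  shows "T (\<Sum>i\<in>S. f i) = Some (\<Sum>i\<in>S. g i)"
  using assms(2)
  by (induction S rule: infinite_finite_induct)
    (simp_all add: linear_op_zero linear_op_add assms(1))

text \<open>Density makes the vector behind the \<open>THE\<close> unique; from here on adjoints are
  handled through the weak identity alone.\<close>

lemma adjoint_op_eq_Some:
  assumes "densely_defined T"
  shows "adjoint_op T v = Some w \<longleftrightarrow> (\<forall>u\<in>dom T. cinner (the (T u)) v = cinner u w)"
proof -
  have unique: "w1 = w2" if "\<forall>u\<in>dom T. cinner (the (T u)) v = cinner u w1"
    "\<forall>u\<in>dom T. cinner (the (T u)) v = cinner u w2" for w1 w2
    using dense_orthogonal_zero[of "dom T" "w1 - w2"] assms that
    by (simp add: densely_defined_def cinner_diff_right)
  have the_eq: "(THE w. \<forall>u\<in>dom T. cinner (the (T u)) v = cinner u w) = w1"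
    if "\<forall>u\<in>dom T. cinner (the (T u)) v = cinner u w1" for w1
    using that unique by (intro the_equality) blast+
  show ?thesis
  proof (cases "\<exists>w1. \<forall>u\<in>dom T. cinner (the (T u)) v = cinner u w1")
    case True
    then obtain w1 where w1: "\<forall>u\<in>dom T. cinner (the (T u)) v = cinner u w1" ..
    then have "adjoint_op T v = Some w1"
      unfolding adjoint_op_def the_eq[OF w1] by (intro if_P exI)
    then show ?thesis
      using w1 unique[OF w1, of w] by (metis option.inject)
  next
    case False
    then have "adjoint_op T v = None"
      unfolding adjoint_op_def by (rule if_not_P)
    then show ?thesis
      using False by (metis option.distinct(1))
  qed
qed

lemma self_adjointI:
  assumes "linear_op T" "densely_defined T"
    and "\<And>v w. T v = Some w \<longleftrightarrow> (\<forall>u\<in>dom T. cinner (the (T u)) v = cinner u w)"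
  shows "self_adjoint T"
proof -
  have "adjoint_op T v = Some w \<longleftrightarrow> T v = Some w" for v w
    unfolding adjoint_op_eq_Some[OF assms(2)] assms(3) ..
  then have "adjoint_op T v = T v" for v
    by (metis not_None_eq)
  then show ?thesis
    using assms(1,2) by (auto simp: self_adjoint_def)
qed

text \<open>Testing against the domain yields both membership in the domain and the value. This is
  how limits and minimisers are placed in the domain later.\<close>

lemma self_adjoint_eq_Some:
  assumes "self_adjoint T"
  shows "T v = Some w \<longleftrightarrow> (\<forall>u\<in>dom T. cinner (the (T u)) v = cinner u w)"
  using adjoint_op_eq_Some[of T v w] assms by (simp add: self_adjoint_def)

lemma self_adjoint_linear: "self_adjoint T \<Longrightarrow> linear_op T"
  by (simp add: self_adjoint_def)

lemma self_adjoint_symmetric: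
  "self_adjoint T \<Longrightarrow> T u = Some u' \<Longrightarrow> T v = Some v' \<Longrightarrow> cinner u' v = cinner u v'"
  using self_adjoint_eq_Some[of T v v'] by force

text \<open>For each fixed test vector the weak identity passes to the limit on both sides.\<close>

lemma self_adjoint_closed:
  assumes T: "self_adjoint T" and u: "\<And>n. T (u n) = Some (u' n)"
    and lim: "u \<longlonglongrightarrow> x" "u' \<longlonglongrightarrow> y"
  shows "T x = Some y"
  unfolding self_adjoint_eq_Some[OF T]
proof
  fix w assume "w \<in> dom T"
  then obtain w' where w: "T w = Some w'" by auto
  have "(\<lambda>n. cinner w' (u n)) \<longlonglongrightarrow> cinner w' x" "(\<lambda>n. cinner w (u' n)) \<longlonglongrightarrow> cinner w y"
    using lim by (auto intro: tendsto_cinner_right)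
  moreover have "cinner w' (u n) = cinner w (u' n)" for n
    using self_adjoint_symmetric[OF T w u] .
  ultimately show "cinner (the (T w)) x = cinner w y"
    using w by (simp add: LIMSEQ_unique)
qed

text \<open>The index set is a parameter because the same facts serve the finite families met while
  the basis is being built and the complete sequence.\<close>

definition orthonormal_on :: "nat set \<Rightarrow> (nat \<Rightarrow> 'a::complex_inner) \<Rightarrow> bool" where
  "orthonormal_on I e \<longleftrightarrow> (\<forall>j\<in>I. \<forall>k\<in>I. cinner (e j) (e k) = (if j = k then 1 else 0))"

definition proj :: "(nat \<Rightarrow> 'a::complex_inner) \<Rightarrow> nat \<Rightarrow> 'a \<Rightarrow> 'a" where
  "proj e n x = (\<Sum>k<n. cinner x (e k) *\<^sub>C e k)"

lemma orthonormal_on_subset: "orthonormal_on I e \<Longrightarrow> J \<subseteq> I \<Longrightarrow> orthonormal_on J e"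
  by (auto simp: orthonormal_on_def subset_iff)

lemma cinner_orthonormal_sum:
  assumes "orthonormal_on I e" "S \<subseteq> I" "finite S" "k \<in> I"
  shows "cinner (\<Sum>j\<in>S. a j *\<^sub>C e j) (e k) = (if k \<in> S then a k else 0)"
proof -
  have "cinner (\<Sum>j\<in>S. a j *\<^sub>C e j) (e k) = (\<Sum>j\<in>S. if j = k then a j else 0)"
    unfolding cinner_sum_left cinner_scaleC_left using assms
    by (intro sum.cong) (auto simp: orthonormal_on_def subset_iff)
  then show ?thesis
    using \<open>finite S\<close> by simp
qed

lemma norm_orthonormal_sum:
  assumes "orthonormal_on I e" "S \<subseteq> I" "finite S"
  shows "(norm (\<Sum>j\<in>S. a j *\<^sub>C e j))\<^sup>2 = (\<Sum>j\<in>S. (cmod (a j))\<^sup>2)"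
proof -
  let ?x = "\<Sum>j\<in>S. a j *\<^sub>C e j"
  have "cinner ?x ?x = (\<Sum>j\<in>S. a j * cinner (e j) ?x)"
    unfolding cinner_sum_left[of _ S] cinner_scaleC_left ..
  also have "\<dots> = (\<Sum>j\<in>S. a j * cnj (a j))"
    using assms cinner_orthonormal_sum[OF assms]
    by (intro sum.cong refl) (subst cinner_commute, auto)
  also have "\<dots> = of_real (\<Sum>j\<in>S. (cmod (a j))\<^sup>2)"
    by (simp flip: complex_norm_square)
  finally show ?thesis
    by (simp only: cinner_self of_real_eq_iff)
qed

lemma cinner_proj:
  assumes "orthonormal_on {..<n} e" "k < n"
  shows "cinner (proj e n x) (e k) = cinner x (e k)"
  unfolding proj_def using cinner_orthonormal_sum[OF assms(1) order_refl] assms(2) by simp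

text \<open>Pythagoras for projection and remainder. Nonnegativity of the left side is Bessel's
  inequality, used in \<open>l2_coef\<close>.\<close>

lemma norm_minus_proj:
  assumes "orthonormal_on {..<n} e"
  shows "(norm (x - proj e n x))\<^sup>2 = (norm x)\<^sup>2 - (\<Sum>k<n. (cmod (cinner x (e k)))\<^sup>2)"
proof -
  have eq: "cinner (proj e n x) y = (\<Sum>k<n. cinner x (e k) * cnj (cinner y (e k)))" for y
    unfolding proj_def cinner_sum_left cinner_scaleC_left
    by (intro sum.cong refl) (metis cinner_commute)
  have "cinner (proj e n x) (x - proj e n x) = 0"
    unfolding eq by (simp add: cinner_diff_left cinner_proj[OF assms])
  then have "inner (proj e n x) (x - proj e n x) = 0"
    by (simp flip: Re_cinner)
  then have "(norm x)\<^sup>2 = (norm (proj e n x))\<^sup>2 + (norm (x - proj e n x))\<^sup>2"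
    by (simp add: power2_norm_eq_inner inner_diff_left inner_diff_right inner_commute)
  moreover have "(norm (proj e n x))\<^sup>2 = (\<Sum>k<n. (cmod (cinner x (e k)))\<^sup>2)"
    unfolding proj_def by (rule norm_orthonormal_sum[OF assms]) auto
  ultimately show ?thesis by simp
qed

lemma norm_minus_proj_le:
  assumes "orthonormal_on {..<n} e"
  shows "norm (x - proj e n x) \<le> norm x"
  by (rule power2_le_imp_le) (simp_all add: norm_minus_proj[OF assms] sum_nonneg)

section \<open>Orthonormal bases and diagonal operators\<close>

text \<open>Comparing graphs settles equality of values and of domains at once.\<close>

lemma map_eqI: "(\<And>x y. f x = Some y \<longleftrightarrow> g x = Some y) \<Longrightarrow> f = g"
  by (rule ext) (metis not_None_eq)

lemma in_dom_map_comp_iff: "x \<in> dom (f \<circ>\<^sub>m g) \<longleftrightarrow> (\<exists>y. g x = Some y \<and> y \<in> dom f)"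
  by (auto simp: map_comp_Some_iff)

section \<open>Square-summable sequences and expansions in an orthonormal basis\<close>

definition l2 :: "(nat \<Rightarrow> complex) \<Rightarrow> bool" where
  "l2 a \<longleftrightarrow> summable (\<lambda>n. (cmod (a n))\<^sup>2)"

lemma l2_bound:
  assumes "l2 b" "\<And>n. cmod (a n) \<le> K * cmod (b n)"
  shows "l2 a"
proof -
  have "summable (\<lambda>n. K\<^sup>2 * (cmod (b n))\<^sup>2)"
    using assms(1) unfolding l2_def by (rule summable_mult)
  moreover have "norm ((cmod (a n))\<^sup>2) \<le> K\<^sup>2 * (cmod (b n))\<^sup>2" for n
    using power_mono[OF assms(2), of n 2] by (simp add: power_mult_distrib)
  ultimately show ?thesis
    unfolding l2_def by (rule summable_comparison_test'[where N = 0])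
qed

lemma l2_add:
  assumes "l2 a" "l2 b"
  shows "l2 (\<lambda>n. a n + b n)"
proof -
  have "summable (\<lambda>n. 2 * (cmod (a n))\<^sup>2 + 2 * (cmod (b n))\<^sup>2)"
    using assms unfolding l2_def by (intro summable_add summable_mult)
  moreover have "norm ((cmod (a n + b n))\<^sup>2) \<le> 2 * (cmod (a n))\<^sup>2 + 2 * (cmod (b n))\<^sup>2" for n
    using power_mono[OF norm_triangle_ineq[of "a n" "b n"], of 2]
      sum_squares_bound[of "cmod (a n)" "cmod (b n)"]
    by (simp add: power2_sum)
  ultimately show ?thesis
    unfolding l2_def by (rule summable_comparison_test'[where N = 0])
qed

lemma l2_finite: "(\<And>n. n \<ge> N \<Longrightarrow> a n = 0) \<Longrightarrow> l2 a"
  unfolding l2_def by (rule summable_finite[of "{..<N}"]) (auto simp: not_less)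

text \<open>Totality is phrased through the orthogonal complement, the form in which the eigenvector
  construction delivers it; convergence of expansions is then derived from completeness in
  \<open>proj_tendsto\<close>.\<close>

locale hilbert_basis =
  fixes e :: "nat \<Rightarrow> 'h::{complex_inner, complete_space}"
  assumes orthonormal: "orthonormal_on UNIV e"
    and total: "(\<And>n. cinner x (e n) = 0) \<Longrightarrow> x = 0"
begin

abbreviation coef :: "'h \<Rightarrow> nat \<Rightarrow> complex" where
  "coef x n \<equiv> cinner x (e n)"

lemma coef_basis: "coef (e m) n = (if n = m then 1 else 0)"
  using orthonormal by (auto simp: orthonormal_on_def)

lemma coef_eqI: "(\<And>n. coef x n = coef y n) \<Longrightarrow> x = y"
  using total[of "x - y"] by (simp add: cinner_diff_left)

lemma norm_basis: "norm (e n) = 1"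
  using cinner_self[of "e n"] norm_ge_zero[of "e n"]
  by (simp add: coef_basis power2_eq_1_iff del: norm_ge_zero flip: of_real_power)

text \<open>The squared distance of two partial sums is an increment of the convergent series of
  squares, so the partial sums are Cauchy. Each coefficient of the partial sums is eventually
  constant and hence survives the limit.\<close>

lemma Riesz_Fischer:
  assumes "l2 a"
  obtains x where "(\<lambda>n. \<Sum>k<n. a k *\<^sub>C e k) \<longlonglongrightarrow> x" "\<And>n. coef x n = a n"
proof -
  define X where "X n = (\<Sum>k<n. a k *\<^sub>C e k)" for n
  define S where "S n = (\<Sum>k<n. (cmod (a k))\<^sup>2)" for n
  have diff: "(norm (X m - X n))\<^sup>2 = S n - S m" if "m < n" for m n
  proof -
    have "X n - X m = (\<Sum>k\<in>{m..<n}. a k *\<^sub>C e k)" "S n - S m = (\<Sum>k\<in>{m..<n}. (cmod (a k))\<^sup>2)"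
      unfolding X_def S_def using sum_diff_nat_ivl[of 0 m n] that
      by (simp_all add: atLeast0LessThan)
    then show ?thesis
      using norm_orthonormal_sum[OF orthonormal, of "{m..<n}" a]
      by (simp add: norm_minus_commute[of "X m"])
  qed
  have "Cauchy S"
    using assms unfolding l2_def S_def summable_iff_convergent by (rule convergent_Cauchy)
  have "Cauchy X"
  proof (rule CauchyI')
    fix \<epsilon> :: real assume "0 < \<epsilon>"
    then obtain M where M: "\<And>m n. m \<ge> M \<Longrightarrow> n \<ge> M \<Longrightarrow> norm (S m - S n) < \<epsilon>\<^sup>2"
      using CauchyD[OF \<open>Cauchy S\<close>, of "\<epsilon>\<^sup>2"] by auto
    have "norm (X m - X n) < \<epsilon>" if "m \<ge> M" "n > m" for m n
      using M[of m n] that diff[of m n] \<open>0 < \<epsilon>\<close> by (intro power2_less_imp_less[of _ \<epsilon>]) auto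
    then show "\<exists>M. \<forall>m\<ge>M. \<forall>n>m. dist (X m) (X n) < \<epsilon>"
      unfolding dist_norm by blast
  qed
  then obtain x where x: "X \<longlonglongrightarrow> x"
    using Cauchy_convergent convergent_def by blast
  have "coef x k = a k" for k
  proof -
    have "(\<lambda>n. coef (X n) k) \<longlonglongrightarrow> coef x k"
      by (rule tendsto_cinner_left[OF x])
    moreover have "eventually (\<lambda>n. coef (X n) k = a k) sequentially"
      using eventually_gt_at_top[of k]
      by eventually_elim (simp add: X_def cinner_orthonormal_sum[OF orthonormal])
    ultimately show ?thesis
      by (rule LIMSEQ_unique[OF _ tendsto_eventually])
  qed
  with x show ?thesis
    using that unfolding X_def by blast
qed

lemma ex_coef: "l2 a \<Longrightarrow> \<exists>x. \<forall>n. coef x n = a n"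
  by (rule Riesz_Fischer[of a]) auto

lemma l2_coef: "l2 (coef x)"
  unfolding l2_def
proof (rule summableI_nonneg_bounded)
  fix n
  have "orthonormal_on {..<n} e"
    using orthonormal_on_subset[OF orthonormal] by auto
  then show "(\<Sum>k<n. (cmod (coef x k))\<^sup>2) \<le> (norm x)\<^sup>2"
    using norm_minus_proj[of n e x] zero_le_power2[of "norm (x - proj e n x)"] by simp
qed auto

text \<open>Riesz-Fischer provides some limit of the partial sums; it has the coefficients of
  \<open>x\<close>, so totality identifies it with \<open>x\<close>.\<close>

lemma proj_tendsto: "(\<lambda>n. proj e n x) \<longlonglongrightarrow> x"
proof -
  obtain y where y: "(\<lambda>n. \<Sum>k<n. coef x k *\<^sub>C e k) \<longlonglongrightarrow> y" "\<And>n. coef y n = coef x n"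
    using Riesz_Fischer[OF l2_coef] by blast
  then show ?thesis
    using coef_eqI[of y x] by (simp add: proj_def)
qed

lemma Parseval: "(\<lambda>k. coef x k * cnj (coef y k)) sums cinner x y"
proof -
  have "cinner (proj e n x) y = (\<Sum>k<n. coef x k * cnj (coef y k))" for n
    unfolding proj_def cinner_sum_left cinner_scaleC_left
    by (intro sum.cong refl) (metis cinner_commute)
  then show ?thesis
    using tendsto_cinner_left[OF proj_tendsto, of x y] by (simp add: sums_def)
qed

lemma Parseval_norm: "(\<lambda>k. (cmod (coef x k))\<^sup>2) sums (norm x)\<^sup>2"
proof -
  have "(\<lambda>k. complex_of_real ((cmod (coef x k))\<^sup>2)) sums of_real ((norm x)\<^sup>2)"
    using Parseval[of x x] unfolding complex_norm_square cinner_self .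
  then show ?thesis
    by (simp only: sums_of_real_iff)
qed

lemma coef_proj: "coef (proj e n x) k = (if k < n then coef x k else 0)"
  unfolding proj_def by (simp add: cinner_orthonormal_sum[OF orthonormal])

text \<open>Multiplication of the coefficients by \<open>t\<close> on the maximal domain. Maximality
  is what makes the operator self-adjoint and not merely symmetric.\<close>

definition diag :: "(nat \<Rightarrow> real) \<Rightarrow> 'h \<rightharpoonup> 'h" where
  "diag t x = (if \<exists>y. \<forall>n. coef y n = of_real (t n) * coef x n
    then Some (THE y. \<forall>n. coef y n = of_real (t n) * coef x n) else None)"

lemma diag_eq_Some: "diag t x = Some y \<longleftrightarrow> (\<forall>n. coef y n = of_real (t n) * coef x n)"
proof -
  have the_eq: "(THE y. \<forall>n. coef y n = of_real (t n) * coef x n) = y"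
    if "\<forall>n. coef y n = of_real (t n) * coef x n" for y
    using that by (intro the_equality coef_eqI) auto
  show ?thesis
  proof (cases "\<exists>y. \<forall>n. coef y n = of_real (t n) * coef x n")
    case True
    then obtain y0 where y0: "\<forall>n. coef y0 n = of_real (t n) * coef x n" ..
    have "diag t x = Some y0"
      unfolding diag_def the_eq[OF y0] by (rule if_P) (use y0 in blast)
    then show ?thesis
      using y0 coef_eqI[of y y0] by auto
  qed (auto simp: diag_def)
qed

lemma dom_diag: "x \<in> dom (diag t) \<longleftrightarrow> l2 (\<lambda>n. of_real (t n) * coef x n)"
proof
  assume "x \<in> dom (diag t)"
  then obtain y where "\<forall>n. coef y n = of_real (t n) * coef x n"
    by (auto simp: diag_eq_Some)
  then show "l2 (\<lambda>n. of_real (t n) * coef x n)"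
    using l2_coef[of y] by simp
next
  assume *: "l2 (\<lambda>n. of_real (t n) * coef x n)"
  obtain y where "\<And>n. coef y n = of_real (t n) * coef x n"
    using ex_coef[OF *] by blast
  then show "x \<in> dom (diag t)"
    by (metis diag_eq_Some domI)
qed

lemma coef_diag: "x \<in> dom (diag t) \<Longrightarrow> coef (the (diag t x)) n = of_real (t n) * coef x n"
  using diag_eq_Some[of t x "the (diag t x)"] by auto

lemma diag_basis: "diag t (e n) = Some (t n *\<^sub>R e n)"
  by (auto simp: diag_eq_Some cinner_linear coef_basis)

lemma linear_op_diag: "linear_op (diag t)"
proof -
  have "0 \<in> dom (diag t)"
    by (auto simp: dom_diag l2_def)
  moreover have "diag t (x + y) = Some (the (diag t x) + the (diag t y))"
    if "x \<in> dom (diag t)" "y \<in> dom (diag t)" for x y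
    using that by (auto simp: diag_eq_Some cinner_linear coef_diag distrib_left)
  moreover have "diag t (a *\<^sub>C x) = Some (a *\<^sub>C the (diag t x))" if "x \<in> dom (diag t)" for a x
    using that by (auto simp: diag_eq_Some cinner_linear coef_diag)
  ultimately show ?thesis
    unfolding linear_op_def by blast
qed

lemma proj_in_dom_diag: "proj e n x \<in> dom (diag t)"
  unfolding dom_diag by (rule l2_finite[of n]) (simp add: coef_proj)

lemma densely_defined_diag: "densely_defined (diag t)"
  unfolding densely_defined_def closure_sequential
  using proj_tendsto proj_in_dom_diag by (auto simp: set_eq_iff closure_sequential) metis

text \<open>One direction is Parseval. For the other, testing with the basis vectors determines all
  coefficients of \<open>w\<close>, and the maximal domain then contains \<open>v\<close>.\<close>

lemma self_adjoint_diag: "self_adjoint (diag t)"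
proof (rule self_adjointI[OF linear_op_diag densely_defined_diag])
  fix v w
  show "diag t v = Some w \<longleftrightarrow> (\<forall>u\<in>dom (diag t). cinner (the (diag t u)) v = cinner u w)"
  proof
    assume *: "diag t v = Some w"
    have "cinner (the (diag t u)) v = cinner u w" if "u \<in> dom (diag t)" for u
    proof -
      have "coef (the (diag t u)) k * cnj (coef v k) = coef u k * cnj (coef w k)" for k
        using * that by (simp add: coef_diag diag_eq_Some)
      then show ?thesis
        using Parseval[of "the (diag t u)" v] Parseval[of u w] by (simp add: sums_unique2)
    qed
    then show "\<forall>u\<in>dom (diag t). cinner (the (diag t u)) v = cinner u w" ..
  next
    assume *: "\<forall>u\<in>dom (diag t). cinner (the (diag t u)) v = cinner u w"
    show "diag t v = Some w"
      unfolding diag_eq_Some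
    proof
      fix n
      have "of_real (t n) * cinner (e n) v = cinner (e n) w"
        using *[rule_format, of "e n"] diag_basis[of t n] by (auto simp: cinner_linear)
      then have "cnj (of_real (t n) * cinner (e n) v) = cnj (cinner (e n) w)"
        by simp
      then show "coef w n = of_real (t n) * coef v n"
        by (simp flip: cinner_commute)
    qed
  qed
qed

text \<open>Symmetry against the eigenvectors shows that \<open>diag t\<close> extends
  \<open>T\<close>. A self-adjoint operator has no proper symmetric extension, so the two agree,
  domains included.\<close>

lemma self_adjoint_eq_diag:
  assumes T: "self_adjoint T" and eig: "\<And>n. T (e n) = Some (t n *\<^sub>R e n)"
  shows "T = diag t"
proof (rule map_eqI)
  have le: "diag t x = Some y" if "T x = Some y" for x y
    unfolding diag_eq_Some
    using self_adjoint_symmetric[OF T that eig] by (simp add: cinner_linear)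
  fix x y
  show "T x = Some y \<longleftrightarrow> diag t x = Some y"
  proof
    assume x: "diag t x = Some y"
    show "T x = Some y"
      unfolding self_adjoint_eq_Some[OF T]
      using self_adjoint_symmetric[OF self_adjoint_diag _ x] le by force
  qed (rule le)
qed

text \<open>The product carries its natural domain, so beyond algebra one needs that the domain for
  the squares lies in the domain for \<open>t\<close>. This follows from |t| \<le> 1 + t^2.\<close>

lemma diag_comp_diag: "diag t \<circ>\<^sub>m diag t = diag (\<lambda>n. (t n)\<^sup>2)"
proof (rule map_eqI)
  fix x y
  show "(diag t \<circ>\<^sub>m diag t) x = Some y \<longleftrightarrow> diag (\<lambda>n. (t n)\<^sup>2) x = Some y"
  proof
    assume "(diag t \<circ>\<^sub>m diag t) x = Some y"
    then show "diag (\<lambda>n. (t n)\<^sup>2) x = Some y"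
      by (auto simp: map_comp_Some_iff diag_eq_Some power2_eq_square mult.assoc)
  next
    assume y: "diag (\<lambda>n. (t n)\<^sup>2) x = Some y"
    have "l2 (\<lambda>n. of_real ((t n)\<^sup>2) * coef x n)"
      using y dom_diag[of x "\<lambda>n. (t n)\<^sup>2"] by blast
    have "l2 (\<lambda>n. of_real (1 + (t n)\<^sup>2) * coef x n)"
      using l2_add[OF l2_coef[of x] \<open>l2 (\<lambda>n. of_real ((t n)\<^sup>2) * coef x n)\<close>]
      by (simp add: distrib_right)
    then have "l2 (\<lambda>n. of_real (t n) * coef x n)"
    proof (rule l2_bound[where K = 1])
      fix n
      have "\<bar>t n\<bar> \<le> 1 + (t n)\<^sup>2"
        using sum_squares_bound[of "\<bar>t n\<bar>" 1] by simp
      then have "\<bar>t n\<bar> \<le> \<bar>1 + (t n)\<^sup>2\<bar>"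
        by linarith
      then have "\<bar>t n\<bar> * cmod (coef x n) \<le> \<bar>1 + (t n)\<^sup>2\<bar> * cmod (coef x n)"
        by (intro mult_right_mono) auto
      then show "cmod (of_real (t n) * coef x n) \<le> 1 * cmod (of_real (1 + (t n)\<^sup>2) * coef x n)"
        by (simp only: norm_mult norm_of_real mult_1)
    qed
    then obtain w where w: "diag t x = Some w"
      unfolding dom_diag[symmetric] by blast
    then have "diag t w = Some y"
      using y by (simp add: diag_eq_Some power2_eq_square mult.assoc)
    with w show "(diag t \<circ>\<^sub>m diag t) x = Some y"
      by (simp add: map_comp_Some_iff)
  qed
qed

text \<open>The \<open>THE\<close> calls for uniqueness: any nonnegative self-adjoint root must act
  on each \<open>e n\<close> as multiplication by \<open>sqrt (s n)\<close>, and
  \<open>self_adjoint_eq_diag\<close> then determines it.\<close>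

lemma op_sqrt_diag:
  assumes s: "\<And>n. s n > 0"
  shows "op_sqrt (diag s) = diag (\<lambda>n. sqrt (s n))"
  unfolding op_sqrt_def
proof (rule the_equality)
  have "nonneg_op (diag (\<lambda>n. sqrt (s n)))"
    unfolding nonneg_op_def
  proof
    fix u assume u: "u \<in> dom (diag (\<lambda>n. sqrt (s n)))"
    have "0 \<le> Re (coef (the (diag (\<lambda>n. sqrt (s n)) u)) k * cnj (coef u k))" for k
      unfolding coef_diag[OF u] mult.assoc complex_norm_square[symmetric]
      using less_imp_le[OF s] by simp
    then show "0 \<le> Re (cinner (the (diag (\<lambda>n. sqrt (s n)) u)) u)"
      by (rule sums_le[OF _ sums_zero sums_Re[OF Parseval]])
  qed
  moreover have "diag (\<lambda>n. sqrt (s n)) \<circ>\<^sub>m diag (\<lambda>n. sqrt (s n)) = diag s"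
    using less_imp_le[OF s] by (simp add: diag_comp_diag)
  ultimately show "self_adjoint (diag (\<lambda>n. sqrt (s n))) \<and> nonneg_op (diag (\<lambda>n. sqrt (s n))) \<and>
      diag (\<lambda>n. sqrt (s n)) \<circ>\<^sub>m diag (\<lambda>n. sqrt (s n)) = diag s"
    by (simp add: self_adjoint_diag)
next
  fix S assume "self_adjoint S \<and> nonneg_op S \<and> S \<circ>\<^sub>m S = diag s"
  then have S: "self_adjoint S" "nonneg_op S" "S \<circ>\<^sub>m S = diag s"
    by auto
  note lin = self_adjoint_linear[OF S(1)]
  have "S (e n) = Some (sqrt (s n) *\<^sub>R e n)" for n
  proof -
    obtain f where f: "S (e n) = Some f" "S f = Some (s n *\<^sub>R e n)"
      using diag_basis[of s n] unfolding S(3)[symmetric] by (auto simp: map_comp_Some_iff)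
    \<comment> \<open>Since (S + sqrt s)(S - sqrt s) annihilates \<open>e n\<close>, a nonzero
      \<open>v\<close> would be an eigenvector of \<open>S\<close> for the negative number
      \<open>- sqrt (s n)\<close>.\<close>
    define v where "v = f - sqrt (s n) *\<^sub>R e n"
    have "S v = Some (s n *\<^sub>R e n - sqrt (s n) *\<^sub>R f)"
      unfolding v_def by (intro linear_op_diff[OF lin] linear_op_scaleR[OF lin] f)
    also have "s n *\<^sub>R e n - sqrt (s n) *\<^sub>R f = - sqrt (s n) *\<^sub>R v"
      using s[of n] by (simp add: v_def algebra_simps)
    finally have Sv: "S v = Some (- sqrt (s n) *\<^sub>R v)" .
    have "0 \<le> Re (cinner (the (S v)) v)"
      using S(2) domI[of S, OF Sv] unfolding nonneg_op_def by blast
    then have "0 \<le> Re (cinner (- sqrt (s n) *\<^sub>R v) v)"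
      by (simp only: Sv option.sel)
    then have "sqrt (s n) * (norm v)\<^sup>2 \<le> 0"
      by (simp add: cinner_linear cinner_self flip: of_real_power)
    then have "v = 0"
      using s[of n] by (simp add: mult_le_0_iff not_le)
    then show ?thesis
      using f by (simp add: v_def)
  qed
  then show "S = diag (\<lambda>n. sqrt (s n))"
    by (rule self_adjoint_eq_diag[OF S(1)])
qed

text \<open>Needed to match the constructed sequence \<open>s\<close> with the given enumeration of
  the eigenvalues.\<close>

lemma point_spectrum_diag: "point_spectrum (diag s) = range (\<lambda>n. of_real (s n))"
proof safe
  fix z assume "z \<in> point_spectrum (diag s)"
  then obtain x where x: "x \<in> dom (diag s)" "x \<noteq> 0" "the (diag s x) = z *\<^sub>C x"
    by (auto simp: point_spectrum_def)
  then obtain n where "coef x n \<noteq> 0"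
    using total by blast
  moreover have "of_real (s n) * coef x n = z * coef x n"
    using coef_diag[OF x(1), of n] unfolding x(3) by (simp only: cinner_scaleC_left)
  ultimately have "z = of_real (s n)"
    by simp
  then show "z \<in> range (\<lambda>n. of_real (s n))"
    by blast
next
  fix n
  have "e n \<noteq> 0"
    using norm_basis[of n] by auto
  then show "of_real (s n) \<in> point_spectrum (diag s)"
    unfolding point_spectrum_def using diag_basis[of s n]
    by (auto intro!: bexI[of _ "e n"] simp: scaleR_scaleC)
qed

end

section \<open>Eigenbases of operators with compact resolvent\<close>

lemma bounded_linear_scaleC_left: "bounded_linear (\<lambda>a. a *\<^sub>C (x::'a::complex_inner))"
  by (rule bounded_linear_intro[where K = "norm x"])
    (auto simp: scaleC_add_left scaleC_scaleC scaleR_scaleC scaleR_conv_of_real norm_scaleC)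

lemma bounded_linear_proj: "bounded_linear (proj e n)"
  unfolding proj_def
  by (intro bounded_linear_sum bounded_linear_compose[OF bounded_linear_scaleC_left]
      bounded_linear_cinner_left)

text \<open>The sequence is the image under the resolvent of the sequence (T - z) u, which is
  bounded because \<open>u\<close> is bounded in the graph norm.\<close>

lemma compact_resolvent_subsequence:
  assumes "has_compact_resolvent T" and u: "\<And>n::nat. T (u n) = Some (u' n)"
    and bnd: "\<And>n. norm (u n) \<le> B" "\<And>n. norm (u' n) \<le> B"
  obtains r x where "strict_mono r" "(u \<circ> r) \<longlonglongrightarrow> x"
proof -
  obtain z where z: "bij_betw (op_minus T z) (dom T) UNIV"
    and K: "compact_map (inv_into (dom T) (op_minus T z))"
    using assms(1) by (auto simp: has_compact_resolvent_def resolvent_set_def)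
  define R where "R = inv_into (dom T) (op_minus T z)"
  define S where "S = range (\<lambda>n. op_minus T z (u n))"
  have "norm (op_minus T z (u n)) \<le> B + cmod z * B" for n
  proof -
    have "norm (op_minus T z (u n)) \<le> norm (u' n) + norm (z *\<^sub>C u n)"
      using norm_triangle_ineq4 by (simp add: op_minus_def u)
    also have "\<dots> \<le> B + cmod z * B"
      unfolding norm_scaleC by (intro add_mono bnd mult_left_mono) auto
    finally show ?thesis .
  qed
  then have "bounded S"
    unfolding S_def by (auto intro: boundedI)
  then have "compact (closure (R ` S))"
    using K by (auto simp: compact_map_def R_def)
  moreover have "\<forall>n. u n \<in> closure (R ` S)"
  proof
    fix n
    have "R (op_minus T z (u n)) = u n"
      unfolding R_def using z u by (intro inv_into_f_f) (auto simp: bij_betw_def)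
    then have "u n \<in> R ` S"
      unfolding S_def by (metis rangeI image_eqI)
    then show "u n \<in> closure (R ` S)"
      by (rule closure_subset[THEN subsetD])
  qed
  ultimately show ?thesis
    unfolding compact_eq_seq_compact_metric by (rule seq_compactE) (rule that)
qed

lemma linear_coeff_eq_0:
  fixes b c :: real
  assumes "\<And>t. 0 \<le> 2 * t * b + t\<^sup>2 * c"
  shows "b = 0"
proof (rule ccontr)
  assume "b \<noteq> 0"
  \<comment> \<open>The parabola is tested at t = - b / k. Adding 1 keeps \<open>k\<close> positive
    when c = 0 and makes c - 2 k negative.\<close>
  define k where "k = \<bar>c\<bar> + 1"
  have k: "k > 0" "c < k"
    by (auto simp: k_def)
  have "0 \<le> 2 * (- b / k) * b + (- b / k)\<^sup>2 * c"
    by (rule assms)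
  also have "\<dots> = (b / k)\<^sup>2 * (c - 2 * k)"
    using k by (simp add: field_simps power2_eq_square)
  also have "\<dots> < 0"
    using k \<open>b \<noteq> 0\<close> by (intro mult_pos_neg) auto
  finally show False by simp
qed

text \<open>The vector \<open>w0\<close> guarantees that there is something to minimise over. The
  minimality of \<open>s\<close> is exported as the last conclusion, since monotonicity of the
  eigenvalues and totality of the eigenvectors both rest on it.\<close>

lemma eigenvector_minimizer:
  fixes A :: "'h::{complex_inner, complete_space} \<rightharpoonup> 'h"
  assumes A: "self_adjoint A" "positive_op A" "has_compact_resolvent A"
    and f: "orthonormal_on {..<n} f" "\<And>k. k < n \<Longrightarrow> A (f k) = Some (l k *\<^sub>R f k)"
    and w0: "w0 \<in> dom A" "w0 \<noteq> 0" "\<And>k. k < n \<Longrightarrow> cinner w0 (f k) = 0"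
  obtains x s where "norm x = 1" "\<And>k. k < n \<Longrightarrow> cinner x (f k) = 0" "A x = Some (s *\<^sub>R x)" "s > 0"
    "\<And>w w'. A w = Some w' \<Longrightarrow> (\<And>k. k < n \<Longrightarrow> cinner w (f k) = 0) \<Longrightarrow> s * norm w \<le> norm w'"
proof -
  note lin = self_adjoint_linear[OF A(1)]
  define perp where "perp w \<longleftrightarrow> (\<forall>k<n. cinner w (f k) = 0)" for w
  define Q where "Q = {norm w' | w w'. A w = Some w' \<and> perp w \<and> norm w = 1}"
  define s where "s = Inf Q"
  have normalise: "norm w' / norm w \<in> Q" if "A w = Some w'" "perp w" "w \<noteq> 0" for w w'
  proof -
    have "A ((1 / norm w) *\<^sub>R w) = Some ((1 / norm w) *\<^sub>R w')"
      using that by (intro linear_op_scaleR[OF lin])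
    moreover have "perp ((1 / norm w) *\<^sub>R w)"
      using that by (simp add: perp_def cinner_linear)
    moreover have "norm ((1 / norm w) *\<^sub>R w) = 1"
      using that by simp
    moreover have "norm w' / norm w = norm ((1 / norm w) *\<^sub>R w')"
      by simp
    ultimately show ?thesis
      unfolding Q_def by blast
  qed
  have "Q \<noteq> {}"
    using normalise[of w0] w0 by (auto simp: perp_def)
  have Q_nonneg: "q \<ge> 0" if "q \<in> Q" for q
    using that by (auto simp: Q_def)
  then have "bdd_below Q"
    by (rule bdd_belowI)
  have "s \<ge> 0"
    unfolding s_def using \<open>Q \<noteq> {}\<close> Q_nonneg by (rule cInf_greatest)
  have low: "s * norm w \<le> norm w'" if "A w = Some w'" "perp w" for w w'
  proof (cases "w = 0")
    case False
    have "s \<le> norm w' / norm w"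
      unfolding s_def using normalise[OF that False] \<open>bdd_below Q\<close> by (rule cInf_lower)
    then show ?thesis
      using False by (simp add: pos_le_divide_eq)
  qed simp
  have "\<exists>w w'. A w = Some w' \<and> perp w \<and> norm w = 1 \<and> norm w' < s + inverse (real (Suc j))" for j
  proof -
    have "Inf Q < s + inverse (real (Suc j))"
      by (simp add: s_def)
    then obtain q where "q \<in> Q" "q < s + inverse (real (Suc j))"
      using cInf_lessD[OF \<open>Q \<noteq> {}\<close>] by blast
    then show ?thesis
      unfolding Q_def by blast
  qed
  then obtain W W' where W: "\<And>j. A (W j) = Some (W' j)" "\<And>j. perp (W j)" "\<And>j. norm (W j) = 1"
    "\<And>j. norm (W' j) < s + inverse (real (Suc j))"
    by metis
  have W'_low: "s \<le> norm (W' j)" for j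
    using low[OF W(1,2), of j] by (simp add: W(3))
  have "(\<lambda>j. s + inverse (real (Suc j))) \<longlonglongrightarrow> s + 0"
    by (intro tendsto_add tendsto_const LIMSEQ_inverse_real_of_nat)
  then have lim: "(\<lambda>j. s + inverse (real (Suc j))) \<longlonglongrightarrow> s"
    by simp
  have norm_W': "(\<lambda>j. norm (W' j)) \<longlonglongrightarrow> s"
    by (rule tendsto_sandwich[OF _ _ tendsto_const lim])
      (intro always_eventually allI W'_low less_imp_le[OF W(4)])+
  have nW': "norm (W' j) \<le> s + 1" for j
  proof -
    have "inverse (real (Suc j)) \<le> 1"
      by (simp add: field_simps)
    then show ?thesis
      using W(4)[of j] by linarith
  qed
  have nW: "norm (W j) \<le> s + 1" for j
    using \<open>s \<ge> 0\<close> by (simp add: W(3))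
  obtain r x where r: "strict_mono r" and x: "(W \<circ> r) \<longlonglongrightarrow> x"
    by (rule compact_resolvent_subsequence[OF A(3) W(1) nW nW'])
  define U where "U j = W (r j)" for j
  define U' where "U' j = W' (r j)" for j
  have U: "\<And>j. A (U j) = Some (U' j)" "\<And>j. perp (U j)" "\<And>j. norm (U j) = 1"
    by (simp_all add: U_def U'_def W)
  have "U \<longlonglongrightarrow> x"
    using x by (simp add: U_def[abs_def] comp_def)
  have norm_U': "(\<lambda>j. norm (U' j)) \<longlonglongrightarrow> s"
    using LIMSEQ_subseq_LIMSEQ[OF norm_W' r] by (simp add: U'_def comp_def)
  \<comment> \<open>By the parallelogram law a minimising sequence converges in the graph norm.\<close>
  have parallelogram: "(norm (U' i - U' j))\<^sup>2 \<le> 2 * ((norm (U' i))\<^sup>2 - s\<^sup>2)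
      + 2 * ((norm (U' j))\<^sup>2 - s\<^sup>2) + (s * norm (U i - U j))\<^sup>2" for i j
  proof -
    have law: "(norm (a + b))\<^sup>2 + (norm (a - b))\<^sup>2 = 2 * (norm a)\<^sup>2 + 2 * (norm b)\<^sup>2" for a b :: 'h
      by (simp add: power2_norm_eq_inner inner_add_left inner_add_right inner_diff_left
          inner_diff_right inner_commute)
    have "s * norm (U i + U j) \<le> norm (U' i + U' j)"
      using U(2)[of i] U(2)[of j] linear_op_add[OF lin U(1) U(1)]
      by (intro low) (auto simp: perp_def cinner_linear)
    then have "(s * norm (U i + U j))\<^sup>2 \<le> (norm (U' i + U' j))\<^sup>2"
      using \<open>s \<ge> 0\<close> by (intro power_mono) auto
    moreover have "(norm (U i + U j))\<^sup>2 = 4 - (norm (U i - U j))\<^sup>2"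
      using law[of "U i" "U j"] by (simp add: U(3))
    ultimately show ?thesis
      using law[of "U' i" "U' j"] by (simp add: power_mult_distrib algebra_simps)
  qed
  have "Cauchy U'"
  proof (rule metric_CauchyI)
    fix \<epsilon> :: real assume "\<epsilon> > 0"
    have "Cauchy U"
      by (rule LIMSEQ_imp_Cauchy) fact
    \<comment> \<open>Each of the three terms of \<open>parallelogram\<close> is to contribute at
      most \<epsilon>^2 / 4. Dividing by s + 1 and not by s allows for s = 0, which is excluded only
      at the end.\<close>
    have "\<epsilon> / (2 * (s + 1)) > 0"
      using \<open>\<epsilon> > 0\<close> \<open>s \<ge> 0\<close> by simp
    then obtain M1 where
      M1: "\<And>i j. i \<ge> M1 \<Longrightarrow> j \<ge> M1 \<Longrightarrow> norm (U i - U j) < \<epsilon> / (2 * (s + 1))"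
      using metric_CauchyD[OF \<open>Cauchy U\<close>] unfolding dist_norm by blast
    have "(\<lambda>j. (norm (U' j))\<^sup>2 - s\<^sup>2) \<longlonglongrightarrow> s\<^sup>2 - s\<^sup>2"
      by (intro tendsto_intros norm_U')
    then have "eventually (\<lambda>j. (norm (U' j))\<^sup>2 - s\<^sup>2 < \<epsilon>\<^sup>2 / 8) sequentially"
      using \<open>\<epsilon> > 0\<close> by (intro order_tendstoD) auto
    then obtain M2 where M2: "\<And>j. j \<ge> M2 \<Longrightarrow> (norm (U' j))\<^sup>2 - s\<^sup>2 < \<epsilon>\<^sup>2 / 8"
      by (auto simp: eventually_sequentially)
    have "dist (U' i) (U' j) < \<epsilon>" if "i \<ge> max M1 M2" "j \<ge> max M1 M2" for i j
    proof -
      have "norm (U i - U j) * (2 * (s + 1)) < \<epsilon>"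
        using M1[of i j] that \<open>s \<ge> 0\<close> by (subst pos_less_divide_eq[symmetric]) auto
      then have "2 * (s * norm (U i - U j)) + 2 * norm (U i - U j) < \<epsilon>"
        by (simp add: algebra_simps)
      then have "s * norm (U i - U j) \<le> \<epsilon> / 2"
        using norm_ge_zero[of "U i - U j"] by linarith
      then have "(s * norm (U i - U j))\<^sup>2 \<le> (\<epsilon> / 2)\<^sup>2"
        using \<open>s \<ge> 0\<close> by (intro power_mono) auto
      then have "(norm (U' i - U' j))\<^sup>2 < 2 * (\<epsilon>\<^sup>2 / 8) + 2 * (\<epsilon>\<^sup>2 / 8) + (\<epsilon> / 2)\<^sup>2"
        using parallelogram[of i j] M2[of i] M2[of j] that by simp
      also have "\<dots> \<le> \<epsilon>\<^sup>2"
        by (simp add: power_divide)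
      finally show ?thesis
        unfolding dist_norm using \<open>\<epsilon> > 0\<close> by (intro power2_less_imp_less[of _ \<epsilon>]) auto
    qed
    then show "\<exists>M. \<forall>i\<ge>M. \<forall>j\<ge>M. dist (U' i) (U' j) < \<epsilon>"
      by blast
  qed
  then obtain y where "U' \<longlonglongrightarrow> y"
    using Cauchy_convergent convergent_def by blast
  have Ax: "A x = Some y"
    by (rule self_adjoint_closed[OF A(1) U(1) \<open>U \<longlonglongrightarrow> x\<close> \<open>U' \<longlonglongrightarrow> y\<close>])
  have "norm x = 1"
    using tendsto_norm[OF \<open>U \<longlonglongrightarrow> x\<close>] by (simp add: U(3) LIMSEQ_const_iff)
  have "norm y = s"
    using tendsto_norm[OF \<open>U' \<longlonglongrightarrow> y\<close>] norm_U' LIMSEQ_unique by blast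
  have x_perp: "cinner x (f k) = 0" if "k < n" for k
    using tendsto_cinner_left[OF \<open>U \<longlonglongrightarrow> x\<close>, of "f k"] U(2) that
    by (simp add: perp_def LIMSEQ_const_iff)
  have y_perp: "cinner y (f k) = 0" if "k < n" for k
    using self_adjoint_symmetric[OF A(1) Ax f(2)[OF that]] x_perp[OF that]
    by (simp add: cinner_linear)
  \<comment> \<open>First variation: |A w|^2 - s^2 |w|^2 is nonnegative on the admissible vectors
    and vanishes at \<open>x\<close>, so its derivative there is zero in every admissible
    direction.\<close>
  have variation: "inner y w' = s\<^sup>2 * inner x w" if w: "A w = Some w'" "perp w" for w w'
  proof -
    have "0 \<le> 2 * t * (inner y w' - s\<^sup>2 * inner x w) + t\<^sup>2 * ((norm w')\<^sup>2 - s\<^sup>2 * (norm w)\<^sup>2)" for t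
    proof -
      have "A (x + t *\<^sub>R w) = Some (y + t *\<^sub>R w')"
        using w by (intro linear_op_add[OF lin] linear_op_scaleR[OF lin] Ax)
      moreover have "perp (x + t *\<^sub>R w)"
        using w x_perp by (simp add: perp_def cinner_linear)
      ultimately have "(s * norm (x + t *\<^sub>R w))\<^sup>2 \<le> (norm (y + t *\<^sub>R w'))\<^sup>2"
        using low \<open>s \<ge> 0\<close> by (intro power_mono) auto
      moreover have expand: "(norm (a + t *\<^sub>R b))\<^sup>2 = (norm a)\<^sup>2 + 2 * t * inner a b + t\<^sup>2 * (norm b)\<^sup>2"
        for a b :: 'h
        unfolding power2_norm_eq_inner
        by (simp add: inner_add_left inner_add_right inner_commute power2_eq_square algebra_simps)
      ultimately show ?thesis
        using \<open>norm x = 1\<close> \<open>norm y = s\<close> by (simp add: power_mult_distrib algebra_simps)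
    qed
    then have "inner y w' - s\<^sup>2 * inner x w = 0"
      by (rule linear_coeff_eq_0)
    then show ?thesis by simp
  qed
  \<comment> \<open>Subtracting the projection onto the earlier eigenvectors makes any
    \<open>w\<close> admissible. The removed part contributes nothing, because both \<open>x\<close>
    and \<open>y\<close> are orthogonal to these eigenvectors.\<close>
  have weak: "inner w' y = s\<^sup>2 * inner w x" if w: "A w = Some w'" for w w'
  proof -
    define p where "p = (\<Sum>k<n. cinner w (f k) *\<^sub>C l k *\<^sub>R f k)"
    have "A (proj f n w) = Some p"
      unfolding proj_def p_def by (intro linear_op_sum[OF lin] linear_op_scaleC[OF lin] f) auto
    then have "A (w - proj f n w) = Some (w' - p)"
      by (intro linear_op_diff[OF lin] w)
    moreover have "perp (w - proj f n w)"
      by (simp add: perp_def cinner_linear cinner_proj[OF f(1)])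
    ultimately have "inner y (w' - p) = s\<^sup>2 * inner x (w - proj f n w)"
      by (rule variation)
    moreover have "cinner p y = 0"
      using y_perp unfolding p_def cinner_sum_left
      by (intro sum.neutral) (auto simp: cinner_linear cinner_commute[of "f _" y])
    then have "inner p y = 0"
      by (simp flip: Re_cinner)
    moreover have "cinner (proj f n w) x = 0"
      using x_perp unfolding proj_def cinner_sum_left
      by (intro sum.neutral) (auto simp: cinner_linear cinner_commute[of "f _" x])
    then have "inner (proj f n w) x = 0"
      by (simp flip: Re_cinner)
    ultimately show ?thesis
      by (simp add: inner_diff_right inner_commute[of y] inner_commute[of x])
  qed
  \<comment> \<open>The real identity for \<open>w\<close> and for \<i> w together gives the complex
    one.\<close>
  have weak_complex: "cinner w' y = cinner w (s\<^sup>2 *\<^sub>R x)" if w: "A w = Some w'" for w w'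
  proof (rule complex_eqI)
    show "Re (cinner w' y) = Re (cinner w (s\<^sup>2 *\<^sub>R x))"
      using weak[OF w] by (simp add: Re_cinner)
    have "Re (cinner (\<i> *\<^sub>C w') y) = Re (cinner (\<i> *\<^sub>C w) (s\<^sup>2 *\<^sub>R x))"
      using weak[OF linear_op_scaleC[OF lin w, of \<i>]] by (simp add: Re_cinner)
    then show "Im (cinner w' y) = Im (cinner w (s\<^sup>2 *\<^sub>R x))"
      by (simp add: cinner_scaleC_left)
  qed
  \<comment> \<open>The weak equation also shows that y = A x lies in the domain again, so that A^2
    x makes sense.\<close>
  have Ay: "A y = Some (s\<^sup>2 *\<^sub>R x)"
    unfolding self_adjoint_eq_Some[OF A(1)] using weak_complex by auto
  \<comment> \<open>The minimiser satisfies \<open>(A + s) (A - s) x = 0\<close>, and \<open>A + s\<close> is injective by positivity.\<close>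
  define v where "v = y - s *\<^sub>R x"
  have "A v = Some (s\<^sup>2 *\<^sub>R x - s *\<^sub>R y)"
    unfolding v_def by (intro linear_op_diff[OF lin] linear_op_scaleR[OF lin] Ax Ay)
  also have "s\<^sup>2 *\<^sub>R x - s *\<^sub>R y = - s *\<^sub>R v"
    by (simp add: v_def algebra_simps power2_eq_square)
  finally have Av: "A v = Some (- s *\<^sub>R v)" .
  have "v = 0"
  proof (rule ccontr)
    assume "v \<noteq> 0"
    then have "0 < Re (cinner (the (A v)) v)"
      using A(2) Av unfolding positive_op_def by blast
    also have "\<dots> = - s * (norm v)\<^sup>2"
      unfolding Av option.sel cinner_scaleR_left cinner_self by simp
    finally show False
      using \<open>s \<ge> 0\<close> by (simp add: mult_less_0_iff)
  qed
  then have Ax': "A x = Some (s *\<^sub>R x)"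
    using Ax by (simp add: v_def)
  have "x \<noteq> 0"
    using \<open>norm x = 1\<close> by auto
  then have "0 < Re (cinner (the (A x)) x)"
    using A(2) Ax unfolding positive_op_def by blast
  then have "s > 0"
    by (simp add: Ax' cinner_scaleR_left cinner_self \<open>norm x = 1\<close>)
  with that[OF \<open>norm x = 1\<close> x_perp Ax'] low show ?thesis
    by (simp add: perp_def)
qed

text \<open>The remainder w - proj w stays in the domain because the family does. If all these
  remainders vanished, the continuous projection would be the identity on a dense set, hence
  everywhere, and the space would be spanned by finitely many vectors.\<close>

lemma ex_orthogonal_in_dom:
  fixes A :: "'h::{complex_inner, complete_space} \<rightharpoonup> 'h"
  assumes inf: "\<not> (\<exists>B::'h set. finite B \<and> module.span scaleC B = UNIV)"
    and A: "self_adjoint A" and f: "orthonormal_on {..<n} f" "f ` {..<n} \<subseteq> dom A"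
  obtains w where "w \<in> dom A" "w \<noteq> 0" "\<And>k. k < n \<Longrightarrow> cinner w (f k) = 0"
proof -
  note lin = self_adjoint_linear[OF A]
  have "\<exists>w. w \<in> dom A \<and> w \<noteq> 0 \<and> (\<forall>k<n. cinner w (f k) = 0)"
  proof (rule ccontr)
    assume "\<not> ?thesis"
    then have zero: "w = 0" if "w \<in> dom A" "\<forall>k<n. cinner w (f k) = 0" for w
      using that by blast
    have "proj f n w = w" if "w \<in> dom A" for w
    proof -
      have "A (proj f n w) = Some (\<Sum>k<n. cinner w (f k) *\<^sub>C the (A (f k)))"
        unfolding proj_def using f(2)
        by (intro linear_op_sum[OF lin] linear_op_scaleC[OF lin]) auto
      then have "A (w - proj f n w) = Some (the (A w) - (\<Sum>k<n. cinner w (f k) *\<^sub>C the (A (f k))))"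
        using that by (intro linear_op_diff[OF lin]) auto
      then have "w - proj f n w = 0"
        by (intro zero) (auto simp: cinner_linear cinner_proj[OF f(1)])
      then show ?thesis by simp
    qed
    moreover have "closed {w. proj f n w = w}"
      by (intro closed_Collect_eq linear_continuous_on bounded_linear_proj continuous_intros)
    ultimately have "closure (dom A) \<subseteq> {w. proj f n w = w}"
      by (intro closure_minimal) auto
    then have "proj f n w = w" for w
      using A by (auto simp: self_adjoint_def densely_defined_def)
    moreover have "proj f n w \<in> module.span scaleC (f ` {..<n})" for w
      unfolding proj_def by (intro module.span_sum module.span_scale module.span_base module_scaleC) auto
    ultimately have "module.span scaleC (f ` {..<n}) = UNIV"
      by (metis UNIV_eq_I)
    then show False
      using inf by blast
  qed
  then show ?thesis
    using that by blast
qed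

text \<open>Minimality makes \<open>s\<close> nondecreasing, so if it did not diverge it would be
  bounded, and the compact resolvent would give an orthonormal sequence a convergent subsequence.
  Divergence of \<open>s\<close> in turn forces the expansions of domain vectors to
  converge.\<close>

lemma ex_eigenbasis:
  fixes A :: "'h::{complex_inner, complete_space} \<rightharpoonup> 'h"
  assumes inf: "\<not> (\<exists>B::'h set. finite B \<and> module.span scaleC B = UNIV)"
    and A: "self_adjoint A" "positive_op A" "has_compact_resolvent A"
  obtains e s where "hilbert_basis e" "\<And>n. s n > 0" "filterlim s at_top sequentially"
    "A = hilbert_basis.diag e s"
proof -
  note lin = self_adjoint_linear[OF A(1)]
  \<comment> \<open>The predicate looks at \<open>f\<close> only below \<open>n\<close>, as the
    recursive choice in \<open>dependent_wellorder_choice\<close> demands.\<close>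
  define P where "P f n x \<longleftrightarrow> norm x = 1 \<and> (\<forall>k<n. cinner x (f k) = 0) \<and>
      (\<exists>s>0. A x = Some (s *\<^sub>R x) \<and>
        (\<forall>w w'. A w = Some w' \<longrightarrow> (\<forall>k<n. cinner w (f k) = 0) \<longrightarrow> s * norm w \<le> norm w'))"
    for f :: "nat \<Rightarrow> 'h" and n x
  have orth: "orthonormal_on {..<n} f" if f: "\<And>k. k < n \<Longrightarrow> P f k (f k)" for f n
    unfolding orthonormal_on_def
  proof (intro ballI)
    fix j k assume jk: "j \<in> {..<n}" "k \<in> {..<n}"
    consider "j = k" | "k < j" | "j < k" by linarith
    then show "cinner (f j) (f k) = (if j = k then 1 else 0)"
    proof cases
      case 1
      then show ?thesis
        using f[of j] jk by (simp add: P_def cinner_self)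
    next
      case 2
      then show ?thesis
        using f[of j] jk by (simp add: P_def)
    next
      case 3
      then show ?thesis
        using f[of k] jk cinner_commute[of "f j" "f k"] by (simp add: P_def)
    qed
  qed
  have "\<exists>f. \<forall>n. P f n (f n)"
  proof (rule dependent_wellorder_choice)
    show "P f n x = P g n x" if "\<And>k. k < n \<Longrightarrow> f k = g k" for x f g n
      using that by (simp add: P_def)
  next
    fix n f assume f: "\<And>k. k < n \<Longrightarrow> P f k (f k)"
    then have orth_f: "orthonormal_on {..<n} f"
      by (rule orth)
    from f have "\<forall>k. \<exists>l. k < n \<longrightarrow> A (f k) = Some (l *\<^sub>R f k)"
      unfolding P_def by blast
    then obtain l where l: "\<And>k. k < n \<Longrightarrow> A (f k) = Some (l k *\<^sub>R f k)"
      by metis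
    then have sub: "f ` {..<n} \<subseteq> dom A"
      by auto
    obtain w where w: "w \<in> dom A" "w \<noteq> 0" "\<And>k. k < n \<Longrightarrow> cinner w (f k) = 0"
      by (rule ex_orthogonal_in_dom[OF inf A(1) orth_f sub]) ((rule that; blast) | assumption)+
    obtain x s where "norm x = 1" "\<And>k. k < n \<Longrightarrow> cinner x (f k) = 0" "A x = Some (s *\<^sub>R x)" "s > 0"
      "\<And>w w'. A w = Some w' \<Longrightarrow> (\<And>k. k < n \<Longrightarrow> cinner w (f k) = 0) \<Longrightarrow> s * norm w \<le> norm w'"
      by (rule eigenvector_minimizer[OF A orth_f l w]) ((rule that; blast) | assumption)+
    then have "P f n x"
      unfolding P_def by blast
    then show "\<exists>x. P f n x" ..
  qed
  then obtain e where e: "\<And>n. P e n (e n)"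
    by blast
  then have "\<forall>n. \<exists>s>0. A (e n) = Some (s *\<^sub>R e n) \<and>
      (\<forall>w w'. A w = Some w' \<longrightarrow> (\<forall>k<n. cinner w (e k) = 0) \<longrightarrow> s * norm w \<le> norm w')"
    by (simp add: P_def)
  then obtain s where s_pos: "\<And>n. s n > 0" and eig: "\<And>n. A (e n) = Some (s n *\<^sub>R e n)"
    and low: "\<And>n w w'. A w = Some w' \<Longrightarrow> (\<forall>k<n. cinner w (e k) = 0) \<Longrightarrow> s n * norm w \<le> norm w'"
    by metis
  have ortho: "orthonormal_on I e" for I
    using orth[OF e] by (auto simp: orthonormal_on_def) (metis lessThan_iff less_add_Suc1 less_add_Suc2 add.commute)+
  have norm_e: "norm (e n) = 1" for n
    using e[of n] by (simp add: P_def)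
  have "incseq s"
  proof (rule incseq_SucI)
    fix n
    have "\<forall>k<n. cinner (e (Suc n)) (e k) = 0"
      using e[of "Suc n"] by (simp add: P_def)
    \<comment> \<open>The vector \<open>e (Suc n)\<close> also competes in the minimisation that
      produced \<open>e n\<close>.\<close>
    then have "s n * norm (e (Suc n)) \<le> norm (s (Suc n) *\<^sub>R e (Suc n))"
      by (rule low[OF eig])
    then show "s n \<le> s (Suc n)"
      using s_pos[of "Suc n"] by (simp add: norm_e)
  qed
  have s_lim: "filterlim s at_top sequentially"
  proof (rule ccontr)
    assume "\<not> ?thesis"
    then obtain B where "\<not> eventually (\<lambda>n. B \<le> s n) sequentially"
      by (auto simp: filterlim_at_top)
    then have "s n \<le> B" for n
      using \<open>incseq s\<close> unfolding eventually_sequentially incseq_def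
      by (meson linear order_trans)
    then have bnd: "norm (s n *\<^sub>R e n) \<le> max B 1" for n
      using s_pos[of n] by (simp add: norm_e le_max_iff_disj)
    have bnd': "norm (e n) \<le> max B 1" for n
      by (simp add: norm_e)
    obtain r x where r: "strict_mono r" "(e \<circ> r) \<longlonglongrightarrow> x"
      by (rule compact_resolvent_subsequence[OF A(3) eig bnd' bnd])
    have "Cauchy (e \<circ> r)"
      using r(2) by (rule LIMSEQ_imp_Cauchy)
    then obtain M where M: "\<And>i j. i \<ge> M \<Longrightarrow> j \<ge> M \<Longrightarrow> dist ((e \<circ> r) i) ((e \<circ> r) j) < 1"
      using metric_CauchyD[of "e \<circ> r" 1] by auto
    have "r M \<noteq> r (Suc M)"
      using strict_mono_eq[OF r(1)] by simp
    then have "cinner (e (r M)) (e (r (Suc M))) = 0"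
      using ortho[of UNIV] by (simp add: orthonormal_on_def)
    then have "inner (e (r M)) (e (r (Suc M))) = 0"
      by (simp flip: Re_cinner)
    \<comment> \<open>Distinct orthonormal vectors are at distance sqrt 2, so no subsequence is
      Cauchy.\<close>
    then have "(norm (e (r M) - e (r (Suc M))))\<^sup>2 = 2"
      unfolding power2_norm_eq_inner inner_diff_left inner_diff_right
      by (simp add: inner_commute norm_e flip: power2_norm_eq_inner)
    moreover have "(norm (e (r M) - e (r (Suc M))))\<^sup>2 < 1\<^sup>2"
      using M[of M "Suc M"] by (intro power_strict_mono) (auto simp: dist_norm)
    ultimately show False by simp
  qed
  have basis: "hilbert_basis e"
  proof
    show "orthonormal_on UNIV e"
      by (rule ortho)
    fix y assume y: "\<And>n. cinner y (e n) = 0"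
    show "y = 0"
    proof (rule dense_orthogonal_zero[of "dom A"])
      show "closure (dom A) = UNIV"
        using A(1) by (auto simp: self_adjoint_def densely_defined_def)
    next
      fix x assume "x \<in> dom A"
      then obtain x' where x': "A x = Some x'" by auto
      \<comment> \<open>\<open>A\<close> commutes with the projection, and the remainder is
        orthogonal to the first \<open>n\<close> eigenvectors, so minimality of \<open>s n\<close>
        gives the rate 1 / s n.\<close>
      have le: "norm (x - proj e n x) \<le> norm x' * inverse (s n)" for n
      proof -
        have "A (proj e n x) = Some (\<Sum>k<n. cinner x (e k) *\<^sub>C s k *\<^sub>R e k)"
          unfolding proj_def by (intro linear_op_sum[OF lin] linear_op_scaleC[OF lin] eig)
        also have "(\<Sum>k<n. cinner x (e k) *\<^sub>C s k *\<^sub>R e k) = proj e n x'"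
          unfolding proj_def
          using self_adjoint_symmetric[OF A(1) x' eig]
          by (simp add: cinner_linear scaleR_scaleC scaleC_scaleC mult.commute)
        finally have "A (x - proj e n x) = Some (x' - proj e n x')"
          by (rule linear_op_diff[OF lin x'])
        then have "s n * norm (x - proj e n x) \<le> norm (x' - proj e n x')"
          by (rule low) (simp add: cinner_linear cinner_proj[OF ortho])
        also have "\<dots> \<le> norm x'"
          by (rule norm_minus_proj_le[OF ortho])
        finally show ?thesis
          using s_pos[of n] by (simp add: field_simps)
      qed
      have "(\<lambda>n. norm x' * inverse (s n)) \<longlonglongrightarrow> norm x' * 0"
        using tendsto_inverse_0_at_top[OF s_lim] by (intro tendsto_mult_left)
      then have lim: "(\<lambda>n. norm x' * inverse (s n)) \<longlonglongrightarrow> 0"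
        by simp
      have "(\<lambda>n. x - proj e n x) \<longlonglongrightarrow> 0"
        by (rule Lim_null_comparison[OF always_eventually lim]) (simp add: le)
      then have "(\<lambda>n. cinner (x - proj e n x) y) \<longlonglongrightarrow> cinner 0 y"
        by (rule tendsto_cinner_left)
      moreover have "cinner (proj e n x) y = 0" for n
        using y unfolding proj_def cinner_sum_left
        by (intro sum.neutral) (auto simp: cinner_linear cinner_commute[of "e _" y])
      ultimately show "cinner x y = 0"
        by (simp add: cinner_linear LIMSEQ_const_iff)
    qed
  qed
  show ?thesis
    by (rule that[OF basis s_pos s_lim hilbert_basis.self_adjoint_eq_diag[OF basis A(1) eig]])
qed

section \<open>The damped wave operator\<close>

text \<open>Cramer's rule. Both sides are first cleared of denominators, so that only polynomial
  identities remain.\<close>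

lemma mode_solve:
  fixes a b u v z \<alpha> \<beta> \<delta> s :: complex
  assumes "\<alpha> \<noteq> 0" and q: "\<alpha> * z\<^sup>2 + \<delta> * s * z + \<beta> * s \<noteq> 0"
  defines "q \<equiv> \<alpha> * z\<^sup>2 + \<delta> * s * z + \<beta> * s"
  shows "v - z * u = a \<and> - (s / \<alpha>) * (\<beta> * u + \<delta> * v) - z * v = b \<longleftrightarrow>
    u = - (\<delta> * s + \<alpha> * z) / q * a + - \<alpha> / q * b \<and> v = \<beta> * s / q * a + - (\<alpha> * z) / q * b"
    (is "?l \<longleftrightarrow> ?r")
proof -
  have q0: "q \<noteq> 0"
    using q by (simp add: q_def)
  have l: "?l \<longleftrightarrow> v - z * u = a \<and> s * (\<beta> * u + \<delta> * v) + \<alpha> * z * v = - \<alpha> * b"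
  proof -
    have eq: "- (s / \<alpha>) * (\<beta> * u + \<delta> * v) - z * v = - (s * (\<beta> * u + \<delta> * v) + \<alpha> * z * v) / \<alpha>"
      using \<open>\<alpha> \<noteq> 0\<close> by (simp add: field_simps)
    have "- x / \<alpha> = b \<longleftrightarrow> x = - \<alpha> * b" for x
      using \<open>\<alpha> \<noteq> 0\<close> by (auto simp: divide_eq_eq mult.commute minus_equation_iff[of x])
    then show ?thesis
      by (simp only: eq)
  qed
  have g: "x = A / q * a + B / q * b \<longleftrightarrow> q * x = A * a + B * b" for x A B
  proof -
    have eq: "A / q * a + B / q * b = (A * a + B * b) / q"
      by (simp add: add_divide_distrib)
    show ?thesis
      unfolding eq using q0 by (simp add: nonzero_eq_divide_eq mult.commute[of q])
  qed
  have r: "?r \<longleftrightarrow> q * u = - (\<delta> * s + \<alpha> * z) * a + - \<alpha> * b \<and> q * v = \<beta> * s * a + - (\<alpha> * z) * b"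
    by (simp only: g)
  show ?thesis
    unfolding l r
  proof safe
    assume *: "s * (\<beta> * u + \<delta> * v) + \<alpha> * z * v = - \<alpha> * b"
    show "q * u = - (\<delta> * s + \<alpha> * z) * (v - z * u) + - \<alpha> * b"
      using * unfolding q_def by algebra
    show "q * v = \<beta> * s * (v - z * u) + - (\<alpha> * z) * b"
      using * unfolding q_def by algebra
  next
    assume *: "q * u = - (\<delta> * s + \<alpha> * z) * a + - \<alpha> * b" "q * v = \<beta> * s * a + - (\<alpha> * z) * b"
    have "q * (v - z * u) = q * a"
      using * unfolding q_def by algebra
    then show "v - z * u = a"
      using q0 by simp
    have "q * (s * (\<beta> * u + \<delta> * v) + \<alpha> * z * v) = q * (- \<alpha> * b)"
      using * unfolding q_def by algebra
    then show "s * (\<beta> * u + \<delta> * v) + \<alpha> * z * v = - \<alpha> * b"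
      using mult_left_cancel[OF q0] by blast
  qed
qed

text \<open>From the eigenbasis only positivity and divergence of \<open>s\<close> are kept; the
  operator itself is now \<open>diag s\<close>.\<close>

locale damped_wave = hilbert_basis e for e :: "nat \<Rightarrow> 'h::{complex_inner, complete_space}" +
  fixes s :: "nat \<Rightarrow> real" and \<alpha> c \<delta> :: real
  assumes s_pos: "\<And>n. s n > 0" and s_lim: "filterlim s at_top sequentially"
    and params: "\<alpha> > 0" "c > 0" "\<delta> > 0"
begin

abbreviation root_diag :: "'h \<rightharpoonup> 'h" where
  "root_diag \<equiv> diag (\<lambda>n. sqrt (s n))"

abbreviation V :: "'h set" where
  "V \<equiv> dom root_diag"

abbreviation root :: "'h \<Rightarrow> 'h" where
  "root u \<equiv> the (root_diag u)"

abbreviation W :: "'h \<times> 'h \<rightharpoonup> 'h \<times> 'h" where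
  "W \<equiv> damped_wave_op \<alpha> c \<delta> (diag s)"

definition q :: "nat \<Rightarrow> complex \<Rightarrow> complex" where
  "q n z = of_real \<alpha> * z\<^sup>2 + of_real (\<delta> * s n) * z + of_real (c\<^sup>2 * s n)"

section \<open>The energy space and the damped wave operator in coefficients\<close>

lemma op_sqrt_eq: "op_sqrt (diag s) = root_diag"
  by (rule op_sqrt_diag[OF s_pos])

lemma energy_space_eq: "energy_space (diag s) = V \<times> V"
  by (simp add: energy_space_def op_sqrt_eq)

lemma energy_norm_eq: "energy_norm (diag s) (u, v) = norm (root u, root v)"
  by (simp add: energy_norm_def op_sqrt_eq norm_Pair)

lemma V_add: "u \<in> V \<Longrightarrow> v \<in> V \<Longrightarrow> u + v \<in> V"
  using linear_op_add[OF linear_op_diag] by blast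

lemma V_diff: "u \<in> V \<Longrightarrow> v \<in> V \<Longrightarrow> u - v \<in> V"
  using linear_op_diff[OF linear_op_diag] by blast

lemma V_scaleC: "u \<in> V \<Longrightarrow> a *\<^sub>C u \<in> V"
  using linear_op_scaleC[OF linear_op_diag] by blast

lemma V_scaleR: "u \<in> V \<Longrightarrow> a *\<^sub>R u \<in> V"
  unfolding scaleR_scaleC by (rule V_scaleC)

lemma basis_in_V: "e n \<in> V"
  using diag_basis by blast

lemma root_add: "u \<in> V \<Longrightarrow> v \<in> V \<Longrightarrow> root (u + v) = root u + root v"
  using linear_op_add[OF linear_op_diag] by fastforce

lemma root_diff: "u \<in> V \<Longrightarrow> v \<in> V \<Longrightarrow> root (u - v) = root u - root v"
  using linear_op_diff[OF linear_op_diag] by fastforce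

lemma root_proj: "root (proj e n u) = proj e n (root u)" if "u \<in> V"
  by (rule coef_eqI) (simp add: coef_diag proj_in_dom_diag that coef_proj)

text \<open>The mode equations already enforce the domain condition: they say that A maps c^2 u +
  \<delta> v to - \<alpha> (g + z v), which lies in \<open>V\<close>.\<close>

lemma damped_waveI:
  assumes V: "u \<in> V" "v \<in> V" "f \<in> V" "g \<in> V"
    and eq: "\<And>n. coef v n - z * coef u n = coef f n"
      "\<And>n. - (of_real (s n) / of_real \<alpha>) * (of_real (c\<^sup>2) * coef u n + of_real \<delta> * coef v n)
        - z * coef v n = coef g n"
  shows "(u, v) \<in> dom W" "op_minus W z (u, v) = (f, g)"
proof -
  define x where "x = c\<^sup>2 *\<^sub>R u + \<delta> *\<^sub>R v"
  define y where "y = (- \<alpha>) *\<^sub>R (g + z *\<^sub>C v)"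
  have "diag s x = Some y"
    unfolding diag_eq_Some
  proof
    fix n
    show "coef y n = of_real (s n) * coef x n"
      using params unfolding x_def y_def cinner_linear eq(2)[symmetric] by (simp add: field_simps)
  qed
  moreover have "y \<in> V"
    unfolding y_def by (intro V_scaleR V_add V_scaleC V)
  ultimately have "x \<in> dom (op_three_halves (diag s))"
    unfolding op_three_halves_def op_sqrt_eq in_dom_map_comp_iff by blast
  then have W: "W (u, v) = Some (v, - ((1 / \<alpha>) *\<^sub>R y))"
    using V \<open>diag s x = Some y\<close> by (simp add: damped_wave_op_def energy_space_eq x_def)
  then show "(u, v) \<in> dom W"
    by blast
  have "v - z *\<^sub>C u = f"
    by (rule coef_eqI) (simp add: cinner_linear eq)
  moreover have "- ((1 / \<alpha>) *\<^sub>R y) - z *\<^sub>C v = g"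
    using params by (simp add: y_def)
  ultimately show "op_minus W z (u, v) = (f, g)"
    by (simp add: op_minus_def W scaleC_prod_def)
qed

text \<open>Conversely, the A^(3/2) condition is what puts the second component of the image into
  \<open>V\<close>, so the operator maps into the energy space.\<close>

lemma damped_waveD:
  assumes "x \<in> dom W"
  obtains u v f g where "x = (u, v)" "op_minus W z x = (f, g)" "u \<in> V" "v \<in> V" "f \<in> V" "g \<in> V"
    "\<And>n. coef v n - z * coef u n = coef f n"
    "\<And>n. - (of_real (s n) / of_real \<alpha>) * (of_real (c\<^sup>2) * coef u n + of_real \<delta> * coef v n)
        - z * coef v n = coef g n"
proof -
  obtain u v where x: "x = (u, v)"
    by (cases x)
  have uv: "u \<in> V" "v \<in> V" and "c\<^sup>2 *\<^sub>R u + \<delta> *\<^sub>R v \<in> dom (op_three_halves (diag s))"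
    using assms by (auto simp: x damped_wave_op_def energy_space_eq split: if_splits)
  then obtain y where y: "diag s (c\<^sup>2 *\<^sub>R u + \<delta> *\<^sub>R v) = Some y" "y \<in> V"
    unfolding op_three_halves_def op_sqrt_eq in_dom_map_comp_iff by blast
  then have W: "W x = Some (v, - ((1 / \<alpha>) *\<^sub>R y))"
    using assms by (auto simp: x damped_wave_op_def split: if_splits)
  show ?thesis
  proof (rule that[OF x _ uv])
    show "op_minus W z x = (v - z *\<^sub>C u, (- (1 / \<alpha>)) *\<^sub>R y - z *\<^sub>C v)"
      by (simp add: op_minus_def W[unfolded x] scaleC_prod_def x)
    show "v - z *\<^sub>C u \<in> V" "(- (1 / \<alpha>)) *\<^sub>R y - z *\<^sub>C v \<in> V"
      by (intro V_diff V_scaleC V_scaleR uv y)+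
    fix n
    show "coef v n - z * coef u n = coef (v - z *\<^sub>C u) n"
      by (simp add: cinner_linear)
    have "coef y n = of_real (s n) * (of_real (c\<^sup>2) * coef u n + of_real \<delta> * coef v n)"
      using y(1) unfolding diag_eq_Some by (simp add: cinner_linear)
    then show "- (of_real (s n) / of_real \<alpha>) * (of_real (c\<^sup>2) * coef u n + of_real \<delta> * coef v n)
        - z * coef v n = coef ((- (1 / \<alpha>)) *\<^sub>R y - z *\<^sub>C v) n"
      by (simp add: cinner_linear)
  qed
qed

section \<open>Solving mode by mode, and the three parts of the spectrum\<close>

lemma mode_iff:
  assumes "q n z \<noteq> 0"
  shows "v - z * u = a \<and>
      - (of_real (s n) / of_real \<alpha>) * (of_real (c\<^sup>2) * u + of_real \<delta> * v) - z * v = b \<longleftrightarrow>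
    u = - (of_real (\<delta> * s n) + of_real \<alpha> * z) / q n z * a + - of_real \<alpha> / q n z * b \<and>
    v = of_real (c\<^sup>2 * s n) / q n z * a + - (of_real \<alpha> * z) / q n z * b"
  using mode_solve[of "of_real \<alpha>" z "of_real \<delta>" "of_real (s n)" "of_real (c\<^sup>2)" v u a b] assms params
  by (simp add: q_def)

lemma point_spectrum_damped_wave: "point_spectrum W = {z. \<exists>n. q n z = 0}"
proof safe
  fix z assume "z \<in> point_spectrum W"
  then obtain x where x: "x \<in> dom W" "x \<noteq> 0" "op_minus W z x = 0"
    by (auto simp: point_spectrum_def op_minus_def)
  obtain u v f g where uv: "x = (u, v)" "op_minus W z x = (f, g)" "\<And>n. coef v n - z * coef u n = coef f n"
    "\<And>n. - (of_real (s n) / of_real \<alpha>) * (of_real (c\<^sup>2) * coef u n + of_real \<delta> * coef v n)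
        - z * coef v n = coef g n"
    by (rule damped_waveD[OF x(1), of z]) (rule that; blast)
  have "f = 0" "g = 0"
    using uv(2) x(3) by (simp_all add: zero_prod_def)
  show "\<exists>n. q n z = 0"
  proof (rule ccontr)
    assume "\<nexists>n. q n z = 0"
    then have "coef u n = 0 \<and> coef v n = 0" for n
      using mode_iff[of n z "coef v n" "coef u n" 0 0] uv(3,4)[of n] \<open>f = 0\<close> \<open>g = 0\<close> by simp
    then have "u = 0" "v = 0"
      using total by blast+
    then show False
      using x(2) uv(1) by (simp add: zero_prod_def)
  qed
next
  fix z n assume q: "q n z = 0"
  \<comment> \<open>The first equation forces v = z u; with u = \<open>e n\<close> the second one
    reduces to the vanishing of \<open>q n z\<close>.\<close>
  have "coef (z *\<^sub>C e n) k - z * coef (e n) k = coef 0 k" for k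
    by (simp add: cinner_linear)
  moreover have "- (of_real (s k) / of_real \<alpha>) * (of_real (c\<^sup>2) * coef (e n) k + of_real \<delta> * coef (z *\<^sub>C e n) k)
        - z * coef (z *\<^sub>C e n) k = coef 0 k" for k
  proof (cases "k = n")
    case True
    have "- (of_real (s n) / of_real \<alpha>) * (of_real (c\<^sup>2) + of_real \<delta> * z) - z * z = - (q n z / of_real \<alpha>)"
      using params by (simp add: q_def field_simps power2_eq_square)
    then show ?thesis
      using q True by (simp add: cinner_linear coef_basis)
  qed (simp add: cinner_linear coef_basis)
  moreover have "(0::'h) \<in> V"
    using linear_op_zero[OF linear_op_diag] by blast
  ultimately have "(e n, z *\<^sub>C e n) \<in> dom W" "op_minus W z (e n, z *\<^sub>C e n) = (0, 0)"
    using damped_waveI[OF basis_in_V V_scaleC[OF basis_in_V]] by blast+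
  moreover have "(e n, z *\<^sub>C e n) \<noteq> 0"
    using norm_basis[of n] by (auto simp: zero_prod_def)
  ultimately show "z \<in> point_spectrum W"
    unfolding point_spectrum_def op_minus_def zero_prod_def[symmetric] by auto
qed

lemma inj_on_damped_wave:
  assumes q: "\<And>n. q n z \<noteq> 0"
  shows "inj_on (op_minus W z) (dom W)"
proof (rule inj_onI)
  fix x x' assume x: "x \<in> dom W" "x' \<in> dom W" "op_minus W z x = op_minus W z x'"
  obtain u v f g where uv: "x = (u, v)" "op_minus W z x = (f, g)" "\<And>n. coef v n - z * coef u n = coef f n"
    "\<And>n. - (of_real (s n) / of_real \<alpha>) * (of_real (c\<^sup>2) * coef u n + of_real \<delta> * coef v n)
        - z * coef v n = coef g n"
    by (rule damped_waveD[OF x(1), of z]) (rule that; blast)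
  obtain u' v' f' g' where uv': "x' = (u', v')" "op_minus W z x' = (f', g')"
    "\<And>n. coef v' n - z * coef u' n = coef f' n"
    "\<And>n. - (of_real (s n) / of_real \<alpha>) * (of_real (c\<^sup>2) * coef u' n + of_real \<delta> * coef v' n)
        - z * coef v' n = coef g' n"
    by (rule damped_waveD[OF x(2), of z]) (rule that; blast)
  have "f' = f" "g' = g"
    using x(3) uv(2) uv'(2) by auto
  then have "coef u n = coef u' n \<and> coef v n = coef v' n" for n
    using mode_iff[OF q, of "coef v n" "coef u n" "coef f n" n "coef g n"]
      mode_iff[OF q, of "coef v' n" "coef u' n" "coef f n" n "coef g n"] uv(3,4)[of n] uv'(3,4)[of n]
    by simp
  then show "x = x'"
    using coef_eqI by (auto simp: uv(1) uv'(1))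
qed

text \<open>Truncated data involve finitely many modes, so no bound uniform in n is required and the
  argument covers z = - c^2 / \<delta> too. Truncation converges in the energy norm because it
  commutes with the square root.\<close>

lemma dense_range_damped_wave:
  assumes q: "\<And>n. q n z \<noteq> 0"
  shows "dense_range (energy_space (diag s)) (energy_norm (diag s)) W z"
  unfolding dense_range_def energy_space_eq
proof safe
  fix f g f' g' and \<epsilon> :: real assume fg: "root_diag f = Some f'" "root_diag g = Some g'" and "\<epsilon> > 0"
  then have V: "f \<in> V" "g \<in> V"
    by auto
  have "(\<lambda>n. norm (proj e n (root f) - root f) + norm (proj e n (root g) - root g)) \<longlonglongrightarrow> 0"
    using tendsto_add[OF tendsto_norm_zero[OF LIM_zero[OF proj_tendsto]]
        tendsto_norm_zero[OF LIM_zero[OF proj_tendsto]]] by simp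
  then have "eventually (\<lambda>n. norm (proj e n (root f) - root f) + norm (proj e n (root g) - root g) < \<epsilon>)
      sequentially"
    using \<open>\<epsilon> > 0\<close> by (rule order_tendstoD)
  then obtain M where
    M: "norm (proj e M (root f) - root f) + norm (proj e M (root g) - root g) < \<epsilon>"
    by (auto simp: eventually_sequentially)
  define a where "a n = - (of_real (\<delta> * s n) + of_real \<alpha> * z) / q n z * coef (proj e M f) n
      + - of_real \<alpha> / q n z * coef (proj e M g) n" for n
  define b where "b n = of_real (c\<^sup>2 * s n) / q n z * coef (proj e M f) n
      + - (of_real \<alpha> * z) / q n z * coef (proj e M g) n" for n
  have ab: "a n = 0" "b n = 0" if "n \<ge> M" for n
    using that by (simp_all add: a_def b_def coef_proj)
  obtain u where u: "\<And>n. coef u n = a n"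
    using ex_coef[OF l2_finite[of M a]] ab by blast
  obtain v where v: "\<And>n. coef v n = b n"
    using ex_coef[OF l2_finite[of M b]] ab by blast
  have "u \<in> V" "v \<in> V"
    unfolding dom_diag by (rule l2_finite[of M]; simp add: u v ab)+
  moreover have "coef v n - z * coef u n = coef (proj e M f) n"
    "- (of_real (s n) / of_real \<alpha>) * (of_real (c\<^sup>2) * coef u n + of_real \<delta> * coef v n)
        - z * coef v n = coef (proj e M g) n" for n
    using mode_iff[OF q, of "coef v n" "coef u n" "coef (proj e M f) n" n "coef (proj e M g) n"]
    unfolding u v a_def b_def by blast+
  ultimately have "(u, v) \<in> dom W" and eq: "op_minus W z (u, v) = (proj e M f, proj e M g)"
    using damped_waveI[OF _ _ proj_in_dom_diag proj_in_dom_diag] by blast+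
  have "energy_norm (diag s) (op_minus W z (u, v) - (f, g))
      = norm (proj e M (root f) - root f, proj e M (root g) - root g)"
    by (simp add: eq energy_norm_eq root_diff proj_in_dom_diag V root_proj)
  also have "\<dots> \<le> norm (proj e M (root f) - root f) + norm (proj e M (root g) - root g)"
    by (rule norm_Pair_le)
  finally have "energy_norm (diag s) (op_minus W z (u, v) - (f, g)) < \<epsilon>"
    using M by simp
  then show "\<exists>x\<in>dom W. energy_norm (diag s) (op_minus W z x - (f, g)) < \<epsilon>"
    using \<open>(u, v) \<in> dom W\<close> by blast
qed

text \<open>Multiplication by a bounded sequence commutes with the square root, so the same bound
  \<open>C\<close> holds for the weighted norm.\<close>

lemma multiplier:
  assumes p: "\<And>n. cmod (p n) \<le> C" and f: "f \<in> V"
  obtains u where "u \<in> V" "\<And>n. coef u n = p n * coef f n" "norm (root u) \<le> C * norm (root f)"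
proof -
  have *: "l2 (\<lambda>n. p n * coef f n)"
    using p by (intro l2_bound[OF l2_coef[of f], of _ C]) (simp add: norm_mult mult_right_mono)
  obtain u where u: "\<And>n. coef u n = p n * coef f n"
    using ex_coef[OF *] by blast
  have "l2 (\<lambda>n. of_real (sqrt (s n)) * coef u n)"
  proof (rule l2_bound)
    show "l2 (\<lambda>n. of_real (sqrt (s n)) * coef f n)"
      using f by (simp only: dom_diag)
    show "cmod (of_real (sqrt (s n)) * coef u n) \<le> C * cmod (of_real (sqrt (s n)) * coef f n)" for n
      using mult_right_mono[OF p, of "cmod (of_real (sqrt (s n)) * coef f n)" n]
      by (simp add: u norm_mult mult_ac)
  qed
  then have "u \<in> V"
    by (simp add: dom_diag)
  have "C \<ge> 0"
    using order_trans[OF norm_ge_zero p[of 0]] .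
  have "(norm (root u))\<^sup>2 \<le> C\<^sup>2 * (norm (root f))\<^sup>2"
  proof (rule sums_le)
    show "(\<lambda>n. (cmod (coef (root u) n))\<^sup>2) sums (norm (root u))\<^sup>2"
      by (rule Parseval_norm)
    show "(\<lambda>n. C\<^sup>2 * (cmod (coef (root f) n))\<^sup>2) sums (C\<^sup>2 * (norm (root f))\<^sup>2)"
      by (intro sums_mult Parseval_norm)
    fix n
    have "coef (root u) n = p n * coef (root f) n"
      using \<open>u \<in> V\<close> f by (simp add: coef_diag u)
    then have "cmod (coef (root u) n) \<le> C * cmod (coef (root f) n)"
      using p[of n] by (simp add: norm_mult mult_right_mono)
    then show "(cmod (coef (root u) n))\<^sup>2 \<le> C\<^sup>2 * (cmod (coef (root f) n))\<^sup>2"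
      unfolding power_mult_distrib[symmetric] by (intro power_mono) auto
  qed
  then have "norm (root u) \<le> C * norm (root f)"
    unfolding power_mult_distrib[symmetric] by (rule power2_le_imp_le) (simp add: \<open>C \<ge> 0\<close>)
  with \<open>u \<in> V\<close> u show ?thesis
    using that by blast
qed

text \<open>After division by \<open>s n\<close> the quotient (1 + s n) / q n z is seen to converge
  to 1 / (\<delta> z + c^2), hence is bounded. The summand 1 lets the bound absorb matrix entries
  with constant numerator as well.\<close>

lemma symbol_lower_bound:
  assumes q: "\<And>n. q n z \<noteq> 0" and z: "of_real \<delta> * z + of_real (c\<^sup>2) \<noteq> 0"
  obtains K where "K > 0" "\<And>n. 1 + s n \<le> K * cmod (q n z)"
proof -
  have inv: "(\<lambda>n. complex_of_real (inverse (s n))) \<longlonglongrightarrow> of_real 0"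
    by (intro tendsto_of_real tendsto_inverse_0_at_top s_lim)
  have "(\<lambda>n. (of_real (inverse (s n)) + 1) /
      (of_real \<alpha> * z\<^sup>2 * of_real (inverse (s n)) + (of_real \<delta> * z + of_real (c\<^sup>2))))
    \<longlonglongrightarrow> (of_real 0 + 1) / (of_real \<alpha> * z\<^sup>2 * of_real 0 + (of_real \<delta> * z + of_real (c\<^sup>2)))"
    using z by (intro tendsto_divide tendsto_add tendsto_mult tendsto_const inv) simp
  also have "(\<lambda>n. (of_real (inverse (s n)) + 1) /
      (of_real \<alpha> * z\<^sup>2 * of_real (inverse (s n)) + (of_real \<delta> * z + of_real (c\<^sup>2))))
    = (\<lambda>n. of_real (1 + s n) / q n z)"
  proof
    fix n
    have "of_real (1 + s n) = of_real (s n) * (of_real (inverse (s n)) + (1::complex))"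
      using s_pos[of n] by (simp add: distrib_left)
    moreover have "q n z = of_real (s n) *
        (of_real \<alpha> * z\<^sup>2 * of_real (inverse (s n)) + (of_real \<delta> * z + of_real (c\<^sup>2)))"
      using s_pos[of n] by (simp add: q_def distrib_left)
    ultimately show "(of_real (inverse (s n)) + 1) /
      (of_real \<alpha> * z\<^sup>2 * of_real (inverse (s n)) + (of_real \<delta> * z + of_real (c\<^sup>2)))
      = of_real (1 + s n) / q n z"
      using s_pos[of n] by simp
  qed
  finally have "Bseq (\<lambda>n. of_real (1 + s n) / q n z)"
    by (intro convergent_imp_Bseq convergentI)
  then obtain K where K: "K > 0" "\<And>n. cmod (of_real (1 + s n) / q n z) \<le> K"
    by (auto elim: BseqE)
  have "1 + s n \<le> K * cmod (q n z)" for n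
  proof -
    have "cmod (of_real (1 + s n)) \<le> K * cmod (q n z)"
      using K(2)[of n] q[of n] unfolding norm_divide by (simp add: pos_divide_le_eq)
    then show ?thesis
      unfolding norm_of_real by linarith
  qed
  with K(1) show ?thesis
    using that by blast
qed

lemma resolvent_damped_wave:
  assumes q: "\<And>n. q n z \<noteq> 0" and z: "of_real \<delta> * z + of_real (c\<^sup>2) \<noteq> 0"
  shows "z \<in> resolvent_set (energy_space (diag s)) (energy_norm (diag s)) W"
proof -
  obtain K where K: "K > 0" "\<And>n. 1 + s n \<le> K * cmod (q n z)"
    using symbol_lower_bound[OF q z] by blast
  \<comment> \<open>The sum of the sizes of all coefficients in the four numerators \<delta> s +
    \<alpha> z, \<alpha>, c^2 s and \<alpha> z, so that each is at most D (1 + s).\<close>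
  define D where "D = \<delta> + \<alpha> * cmod z + \<alpha> + c\<^sup>2"
  define C where "C = D * K"
  have entry: "cmod (w / q n z) \<le> C" if "cmod w \<le> D * (1 + s n)" for w n
  proof -
    have "D \<ge> 0"
      using params by (simp add: D_def)
    then have "cmod w \<le> D * (K * cmod (q n z))"
      using that mult_left_mono[OF K(2)[of n], of D] by linarith
    then show ?thesis
      using q[of n] by (simp add: norm_divide C_def pos_divide_le_eq mult.assoc)
  qed
  have D_expand: "D * (1 + s n) = \<delta> * s n + \<delta> + \<alpha> * cmod z + \<alpha> * cmod z * s n + \<alpha> + \<alpha> * s n + c\<^sup>2 + c\<^sup>2 * s n"
    for n by (simp add: D_def algebra_simps)
  have pos: "0 \<le> \<delta> * s n" "0 \<le> \<alpha> * cmod z * s n" "0 \<le> \<alpha> * s n" "0 \<le> c\<^sup>2 * s n" for n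
    using params less_imp_le[OF s_pos[of n]] by simp_all
  have pos': "0 \<le> \<alpha> * cmod z" "0 \<le> c\<^sup>2"
    using params by simp_all
  have bounds: "cmod (- (of_real (\<delta> * s n) + of_real \<alpha> * z) / q n z) \<le> C"
    "cmod (- of_real \<alpha> / q n z) \<le> C" "cmod (of_real (c\<^sup>2 * s n) / q n z) \<le> C"
    "cmod (- (of_real \<alpha> * z) / q n z) \<le> C" for n
  proof -
    have "cmod (- (of_real (\<delta> * s n) + of_real \<alpha> * z)) \<le> \<delta> * s n + \<alpha> * cmod z"
      using norm_triangle_ineq[of "complex_of_real (\<delta> * s n)" "of_real \<alpha> * z"] pos[of n] pos' params
      unfolding norm_minus_cancel norm_mult norm_of_real by simp
    then have "cmod (- (of_real (\<delta> * s n) + of_real \<alpha> * z)) \<le> D * (1 + s n)"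
      unfolding D_expand using pos[of n] pos' params by linarith
    then show "cmod (- (of_real (\<delta> * s n) + of_real \<alpha> * z) / q n z) \<le> C"
      by (rule entry)
    have "cmod (- of_real \<alpha>) = \<alpha>" "cmod (of_real (c\<^sup>2 * s n)) = c\<^sup>2 * s n"
      "cmod (- (of_real \<alpha> * z)) = \<alpha> * cmod z"
      using pos[of n] pos' params unfolding norm_minus_cancel norm_mult norm_of_real by simp_all
    then have "cmod (- of_real \<alpha>) \<le> D * (1 + s n)" "cmod (of_real (c\<^sup>2 * s n)) \<le> D * (1 + s n)"
      "cmod (- (of_real \<alpha> * z)) \<le> D * (1 + s n)"
      unfolding D_expand using pos[of n] pos' params by linarith+
    then show "cmod (- of_real \<alpha> / q n z) \<le> C" "cmod (of_real (c\<^sup>2 * s n) / q n z) \<le> C"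
      "cmod (- (of_real \<alpha> * z) / q n z) \<le> C"
      by (auto intro: entry)
  qed
  have "C \<ge> 0"
    using order_trans[OF norm_ge_zero bounds(2)[of 0]] .
  \<comment> \<open>Each component of the solution is a sum of two multiplier terms, one for
    \<open>f\<close> and one for \<open>g\<close>; this makes four terms of size at most C times the
    norm of \<open>y\<close>.\<close>
  have solve: "\<exists>x\<in>dom W. op_minus W z x = y \<and> energy_norm (diag s) x \<le> 4 * C * energy_norm (diag s) y"
    if y: "y \<in> V \<times> V" for y
  proof -
    obtain f g where fg: "y = (f, g)" "f \<in> V" "g \<in> V"
      using y by auto
    obtain u1 where u1: "u1 \<in> V" "\<And>n. coef u1 n = - (of_real (\<delta> * s n) + of_real \<alpha> * z) / q n z * coef f n"
      "norm (root u1) \<le> C * norm (root f)"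
      using multiplier[of "\<lambda>n. - (of_real (\<delta> * s n) + of_real \<alpha> * z) / q n z", OF bounds(1) fg(2)] by blast
    obtain u2 where u2: "u2 \<in> V" "\<And>n. coef u2 n = - of_real \<alpha> / q n z * coef g n"
      "norm (root u2) \<le> C * norm (root g)"
      using multiplier[of "\<lambda>n. - of_real \<alpha> / q n z", OF bounds(2) fg(3)] by blast
    obtain v1 where v1: "v1 \<in> V" "\<And>n. coef v1 n = of_real (c\<^sup>2 * s n) / q n z * coef f n"
      "norm (root v1) \<le> C * norm (root f)"
      using multiplier[of "\<lambda>n. of_real (c\<^sup>2 * s n) / q n z", OF bounds(3) fg(2)] by blast
    obtain v2 where v2: "v2 \<in> V" "\<And>n. coef v2 n = - (of_real \<alpha> * z) / q n z * coef g n"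
      "norm (root v2) \<le> C * norm (root g)"
      using multiplier[of "\<lambda>n. - (of_real \<alpha> * z) / q n z", OF bounds(4) fg(3)] by blast
    have "coef (v1 + v2) n - z * coef (u1 + u2) n = coef f n"
      "- (of_real (s n) / of_real \<alpha>) * (of_real (c\<^sup>2) * coef (u1 + u2) n + of_real \<delta> * coef (v1 + v2) n)
          - z * coef (v1 + v2) n = coef g n" for n
      using mode_iff[OF q, of "coef (v1 + v2) n" "coef (u1 + u2) n" "coef f n" n "coef g n"]
      unfolding cinner_add_left u1(2) u2(2) v1(2) v2(2) by blast+
    then have "(u1 + u2, v1 + v2) \<in> dom W" "op_minus W z (u1 + u2, v1 + v2) = y"
      using damped_waveI[OF V_add[OF u1(1) u2(1)] V_add[OF v1(1) v2(1)] fg(2,3)] fg(1) by blast+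
    moreover have "energy_norm (diag s) (u1 + u2, v1 + v2) \<le> 4 * C * energy_norm (diag s) y"
    proof -
      have "energy_norm (diag s) (u1 + u2, v1 + v2) \<le> norm (root u1 + root u2) + norm (root v1 + root v2)"
        by (simp add: energy_norm_eq root_add u1(1) u2(1) v1(1) v2(1) norm_Pair_le)
      also have "\<dots> \<le> norm (root u1) + norm (root u2) + (norm (root v1) + norm (root v2))"
        by (intro add_mono norm_triangle_ineq)
      also have "\<dots> \<le> 2 * (C * norm (root f)) + 2 * (C * norm (root g))"
        using u1(3) u2(3) v1(3) v2(3) by linarith
      also have "\<dots> \<le> 2 * (C * norm (root f, root g)) + 2 * (C * norm (root f, root g))"
        using norm_fst_le[of "root f" "root g"] norm_snd_le[of "root g" "root f"] \<open>C \<ge> 0\<close>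
        by (intro add_mono mult_left_mono) auto
      finally show ?thesis
        by (simp add: fg(1) energy_norm_eq)
    qed
    ultimately show ?thesis by blast
  qed
  have inj: "inj_on (op_minus W z) (dom W)"
    by (rule inj_on_damped_wave[OF q])
  have maps: "op_minus W z x \<in> V \<times> V" if "x \<in> dom W" for x
    by (rule damped_waveD[OF that, of z]) auto
  have "bij_betw (op_minus W z) (dom W) (V \<times> V)"
    unfolding bij_betw_def
  proof (intro conjI inj equalityI image_subsetI maps subsetI)
    fix y assume "y \<in> V \<times> V"
    then show "y \<in> op_minus W z ` dom W"
      using solve[of y] by (metis image_eqI)
  qed
  moreover have "energy_norm (diag s) x \<le> 4 * C * energy_norm (diag s) (op_minus W z x)"
    if x: "x \<in> dom W" for x
  proof -
    obtain x' where x': "x' \<in> dom W" "op_minus W z x' = op_minus W z x"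
      "energy_norm (diag s) x' \<le> 4 * C * energy_norm (diag s) (op_minus W z x)"
      using solve[OF maps[OF x]] by blast
    \<comment> \<open>Injectivity carries the bound from the constructed solution over to the
      arbitrary \<open>x\<close>.\<close>
    then have "x' = x"
      using inj x by (auto dest: inj_onD)
    with x'(3) show ?thesis by simp
  qed
  ultimately show ?thesis
    unfolding resolvent_set_def energy_space_eq by blast
qed

text \<open>Here \<open>q n z\<close> is the constant \<alpha> z^2, so data of size |\<alpha> z^2|
  on mode n have a solution whose second component is of size c^2 s n. No constant \<open>K\<close>
  can dominate this ratio.\<close>

lemma accumulation_point_in_spectrum:
  assumes z: "of_real \<delta> * z + of_real (c\<^sup>2) = 0"
  shows "z \<in> spectrum (energy_space (diag s)) (energy_norm (diag s)) W"
proof (rule ccontr)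
  assume "z \<notin> spectrum (energy_space (diag s)) (energy_norm (diag s)) W"
  then obtain K where K: "\<And>x. x \<in> dom W \<Longrightarrow>
      energy_norm (diag s) x \<le> K * energy_norm (diag s) (op_minus W z x)"
    by (auto simp: spectrum_def resolvent_set_def)
  have root_e: "root (a *\<^sub>C e n) = (a * of_real (sqrt (s n))) *\<^sub>C e n" for a n
  proof -
    have "root_diag (a *\<^sub>C e n) = Some (a *\<^sub>C sqrt (s n) *\<^sub>R e n)"
      by (rule linear_op_scaleC[OF linear_op_diag diag_basis])
    then show ?thesis
      by (simp add: scaleR_scaleC scaleC_scaleC)
  qed
  have root_0: "root 0 = 0"
    using linear_op_zero[OF linear_op_diag] by simp
  have "c\<^sup>2 * s n \<le> K * cmod (of_real \<alpha> * z\<^sup>2)" for n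
  proof -
    \<comment> \<open>The formulas of \<open>mode_iff\<close> for a = q n z and b = 0, with the
      denominator cancelled.\<close>
    define u where "u = (- (of_real (\<delta> * s n) + of_real \<alpha> * z)) *\<^sub>C e n"
    define v where "v = of_real (c\<^sup>2 * s n) *\<^sub>C e n"
    define f where "f = (of_real \<alpha> * z\<^sup>2) *\<^sub>C e n"
    have c: "of_real (c\<^sup>2) = - of_real \<delta> * z"
      using z by (simp add: add_eq_0_iff)
    have "coef v k - z * coef u k = coef f k" for k
      unfolding u_def v_def f_def cinner_scaleC_left of_real_mult c
      by (simp add: coef_basis algebra_simps power2_eq_square)
    moreover have "- (of_real (s k) / of_real \<alpha>) * (of_real (c\<^sup>2) * coef u k + of_real \<delta> * coef v k)
        - z * coef v k = coef 0 k" for k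
      using params unfolding u_def v_def cinner_scaleC_left of_real_mult c
      by (simp add: coef_basis field_simps power2_eq_square)
    moreover have "u \<in> V" "v \<in> V" "f \<in> V" "0 \<in> V"
      unfolding u_def v_def f_def using linear_op_zero[OF linear_op_diag]
      by (auto intro!: V_scaleC basis_in_V)
    ultimately have "(u, v) \<in> dom W" "op_minus W z (u, v) = (f, 0)"
      using damped_waveI by blast+
    then have "energy_norm (diag s) (u, v) \<le> K * energy_norm (diag s) (f, 0)"
      using K by metis
    moreover have "norm (root v) \<le> energy_norm (diag s) (u, v)"
      unfolding energy_norm_eq by (rule norm_snd_le)
    moreover have "norm (root f, 0::'h) = norm (root f)"
      by (simp add: norm_Pair)
    ultimately have "norm (root v) \<le> K * norm (root f)"
      by (simp add: energy_norm_eq root_0)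
    then have "c\<^sup>2 * s n * sqrt (s n) \<le> K * cmod (of_real \<alpha> * z\<^sup>2) * sqrt (s n)"
      unfolding u_def v_def f_def root_e norm_scaleC norm_basis using s_pos[of n]
      by (simp add: norm_mult norm_power)
    then show ?thesis
      using s_pos[of n] by simp
  qed
  then have "s n \<le> K * cmod (of_real \<alpha> * z\<^sup>2) / c\<^sup>2" for n
    using params by (simp add: pos_le_divide_eq mult.commute)
  moreover obtain n where "K * cmod (of_real \<alpha> * z\<^sup>2) / c\<^sup>2 < s n"
    using s_lim unfolding filterlim_at_top_dense eventually_sequentially by blast
  ultimately show False
    by (simp add: not_le[symmetric])
qed

lemma accumulation_point_iff:
  "of_real \<delta> * z + of_real (c\<^sup>2) = 0 \<longleftrightarrow> z = complex_of_real (- (c\<^sup>2 / \<delta>))"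
  using params by (auto simp: field_simps add_eq_0_iff)

lemma accumulation_point_not_eigenvalue:
  assumes "of_real \<delta> * z + of_real (c\<^sup>2) = 0"
  shows "q n z \<noteq> 0"
proof -
  have "q n z = of_real \<alpha> * z\<^sup>2 + of_real (s n) * (of_real \<delta> * z + of_real (c\<^sup>2))"
    by (simp add: q_def algebra_simps)
  moreover have "z \<noteq> 0"
    using assms params by auto
  ultimately show ?thesis
    using assms params by simp
qed

text \<open>Away from the eigenvalues the range is always dense.\<close>

lemma residual_spectrum_damped_wave:
  "residual_spectrum (energy_space (diag s)) (energy_norm (diag s)) W = {}"
  using dense_range_damped_wave
  by (auto simp: residual_spectrum_def point_spectrum_damped_wave)

lemma continuous_spectrum_damped_wave:
  "continuous_spectrum (energy_space (diag s)) (energy_norm (diag s)) W =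
    {complex_of_real (- (c\<^sup>2 / \<delta>))}"
proof (intro equalityI subsetI)
  fix z assume "z \<in> continuous_spectrum (energy_space (diag s)) (energy_norm (diag s)) W"
  then have "z \<notin> resolvent_set (energy_space (diag s)) (energy_norm (diag s)) W"
    "\<And>n. q n z \<noteq> 0"
    by (auto simp: continuous_spectrum_def spectrum_def point_spectrum_damped_wave)
  then show "z \<in> {complex_of_real (- (c\<^sup>2 / \<delta>))}"
    using resolvent_damped_wave accumulation_point_iff by blast
next
  fix z assume "z \<in> {complex_of_real (- (c\<^sup>2 / \<delta>))}"
  then have z: "of_real \<delta> * z + of_real (c\<^sup>2) = 0"
    unfolding accumulation_point_iff by simp
  then show "z \<in> continuous_spectrum (energy_space (diag s)) (energy_norm (diag s)) W"
    using accumulation_point_in_spectrum[OF z] accumulation_point_not_eigenvalue[OF z]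
      dense_range_damped_wave
    by (auto simp: continuous_spectrum_def point_spectrum_damped_wave)
qed

end

section \<open>The two branches of eigenvalues\<close>

text \<open>For Re z \<ge> 0 the imaginary part of the equation, Im z (2 a Re z + b) = 0, makes z
  real; then no term is negative and \<open>k\<close> is positive.\<close>

lemma quadratic_root_Re_neg:
  fixes a b k :: real
  assumes pos: "a > 0" "b > 0" "k > 0" and root: "of_real a * z\<^sup>2 + of_real b * z + of_real k = 0"
  shows "Re z < 0"
proof (rule ccontr)
  assume "\<not> Re z < 0"
  then have "Re z \<ge> 0" by simp
  have Re: "a * ((Re z)\<^sup>2 - (Im z)\<^sup>2) + b * Re z + k = 0"
    using arg_cong[OF root, of Re] by (simp add: power2_eq_square)
  have "Im z * (2 * a * Re z + b) = 0"
    using arg_cong[OF root, of Im] by (simp add: power2_eq_square algebra_simps)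
  moreover have "2 * a * Re z + b > 0"
    using pos \<open>Re z \<ge> 0\<close> by (intro add_nonneg_pos) auto
  ultimately have "Im z = 0" by simp
  then have "a * (Re z)\<^sup>2 + b * Re z + k = 0"
    using Re by simp
  moreover have "a * (Re z)\<^sup>2 \<ge> 0" "b * Re z \<ge> 0"
    using pos \<open>Re z \<ge> 0\<close> by simp_all
  ultimately show False
    using pos by linarith
qed

lemma quadratic_roots:
  fixes a b k :: complex
  assumes "a \<noteq> 0"
  shows "{z. a * z\<^sup>2 + b * z + k = 0} =
    {(- b + csqrt (b\<^sup>2 - 4 * a * k)) / (2 * a), (- b - csqrt (b\<^sup>2 - 4 * a * k)) / (2 * a)}"
proof -
  define d where "d = csqrt (b\<^sup>2 - 4 * a * k)"
  have d: "d\<^sup>2 = b\<^sup>2 - 4 * a * k"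
    by (simp add: d_def)
  have "a * z\<^sup>2 + b * z + k = 0 \<longleftrightarrow> z = (- b + d) / (2 * a) \<or> z = (- b - d) / (2 * a)" for z
  proof -
    have "(z * (2 * a) - (- b + d)) * (z * (2 * a) - (- b - d)) = 4 * a * (a * z\<^sup>2 + b * z + k)"
      using d by algebra
    then have "a * z\<^sup>2 + b * z + k = 0 \<longleftrightarrow> z * (2 * a) - (- b + d) = 0 \<or> z * (2 * a) - (- b - d) = 0"
      using assms by (metis mult_eq_0_iff zero_neq_numeral)
    moreover have nonzero: "2 * a \<noteq> 0"
      using assms by simp
    ultimately show ?thesis
      by (simp only: right_minus_eq nonzero_eq_divide_eq[OF nonzero])
  qed
  then show ?thesis
    unfolding d_def[symmetric] by auto
qed

text \<open>Using \<open>csqrt\<close> defines both branches for every n, also where the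
  discriminant is negative. The plus sign gives the bounded branch.\<close>

lemma damped_roots:
  fixes \<mu> :: "nat \<Rightarrow> real" and \<alpha> c \<delta> :: real
  assumes params: "\<alpha> > 0" "c > 0" "\<delta> > 0" and pos: "\<And>n. \<mu> n > 0"
    and lim: "filterlim \<mu> at_top sequentially"
  obtains l0 l1 :: "nat \<Rightarrow> complex" where
    "\<And>n. {z. complex_of_real \<alpha> * z\<^sup>2 + complex_of_real (\<delta> * \<mu> n) * z
        + complex_of_real (c\<^sup>2 * \<mu> n) = 0} = {l0 n, l1 n}"
    "\<And>n. Re (l0 n) < 0" "\<And>n. Re (l1 n) < 0"
    "\<forall>\<^sub>F n in sequentially. l0 n \<in> \<real> \<and> l1 n \<in> \<real>"
    "l0 \<longlonglongrightarrow> complex_of_real (- (c\<^sup>2 / \<delta>))"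
    "filterlim (\<lambda>n. Re (l1 n)) at_bot sequentially"
proof -
  define d where "d n = (\<delta> * \<mu> n)\<^sup>2 - 4 * \<alpha> * (c\<^sup>2 * \<mu> n)" for n
  define l0 where "l0 n = (- of_real (\<delta> * \<mu> n) + csqrt (of_real (d n))) / (2 * of_real \<alpha>)" for n
  define l1 where "l1 n = (- of_real (\<delta> * \<mu> n) - csqrt (of_real (d n))) / (2 * of_real \<alpha>)" for n
  have roots: "{z. complex_of_real \<alpha> * z\<^sup>2 + complex_of_real (\<delta> * \<mu> n) * z
      + complex_of_real (c\<^sup>2 * \<mu> n) = 0} = {l0 n, l1 n}" for n
    using quadratic_roots[of "of_real \<alpha>" "of_real (\<delta> * \<mu> n)" "of_real (c\<^sup>2 * \<mu> n)"] params
    by (simp add: l0_def l1_def d_def)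
  have "Re z < 0" if "z \<in> {l0 n, l1 n}" for n z
    using that quadratic_root_Re_neg[of \<alpha> "\<delta> * \<mu> n" "c\<^sup>2 * \<mu> n" z] params pos[of n]
    unfolding roots[symmetric] by simp
  then have Re_neg: "Re (l0 n) < 0" "Re (l1 n) < 0" for n
    by blast+
  \<comment> \<open>The threshold comes from d = \<mu> (\<delta>^2 \<mu> - 4 \<alpha> c^2).\<close>
  have large: "\<forall>\<^sub>F n in sequentially. \<mu> n \<ge> 4 * \<alpha> * c\<^sup>2 / \<delta>\<^sup>2"
    using lim unfolding filterlim_at_top by blast
  have d_nonneg: "d n \<ge> 0" if "\<mu> n \<ge> 4 * \<alpha> * c\<^sup>2 / \<delta>\<^sup>2" for n
  proof -
    have "4 * \<alpha> * c\<^sup>2 \<le> \<mu> n * \<delta>\<^sup>2"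
      using that params by (simp add: pos_divide_le_eq)
    then have "4 * \<alpha> * c\<^sup>2 * \<mu> n \<le> \<mu> n * \<delta>\<^sup>2 * \<mu> n"
      using pos[of n] by (intro mult_right_mono) auto
    then show ?thesis
      by (simp add: d_def power2_eq_square mult_ac)
  qed
  have real0: "l0 n = of_real ((- (\<delta> * \<mu> n) + sqrt (d n)) / (2 * \<alpha>))"
    and real1: "l1 n = of_real ((- (\<delta> * \<mu> n) - sqrt (d n)) / (2 * \<alpha>))"
    if "\<mu> n \<ge> 4 * \<alpha> * c\<^sup>2 / \<delta>\<^sup>2" for n
    using d_nonneg[OF that] by (simp_all add: l0_def l1_def)
  have real: "\<forall>\<^sub>F n in sequentially. l0 n \<in> \<real> \<and> l1 n \<in> \<real>"
    using large by eventually_elim (simp only: real0 real1 Reals_of_real simp_thms)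
  \<comment> \<open>This is \<open>sqrt (d n)\<close> divided by \<open>\<mu> n\<close>; unlike
    \<open>sqrt (d n)\<close> it has a finite limit.\<close>
  define S where "S n = sqrt (\<delta>\<^sup>2 - 4 * \<alpha> * c\<^sup>2 * inverse (\<mu> n))" for n
  have "S \<longlonglongrightarrow> sqrt (\<delta>\<^sup>2 - 4 * \<alpha> * c\<^sup>2 * 0)"
    unfolding S_def
    by (intro tendsto_real_sqrt tendsto_diff tendsto_mult tendsto_const tendsto_inverse_0_at_top lim)
  then have "S \<longlonglongrightarrow> \<delta>"
    using params by simp
  then have "(\<lambda>n. - 2 * c\<^sup>2 / (S n + \<delta>)) \<longlonglongrightarrow> - 2 * c\<^sup>2 / (\<delta> + \<delta>)"
    using params by (intro tendsto_intros) auto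
  also have "- 2 * c\<^sup>2 / (\<delta> + \<delta>) = - (c\<^sup>2 / \<delta>)"
    using params by (simp add: field_simps)
  finally have "(\<lambda>n. complex_of_real (- 2 * c\<^sup>2 / (S n + \<delta>))) \<longlonglongrightarrow> of_real (- (c\<^sup>2 / \<delta>))"
    by (rule tendsto_of_real)
  moreover have "\<forall>\<^sub>F n in sequentially. complex_of_real (- 2 * c\<^sup>2 / (S n + \<delta>)) = l0 n"
    using large
  proof eventually_elim
    case (elim n)
    \<comment> \<open>Rationalise the numerator to remove the cancellation of \<open>\<delta> \<mu>\<^sub>n\<close>.\<close>
    have dS: "d n = (\<mu> n)\<^sup>2 * (\<delta>\<^sup>2 - 4 * \<alpha> * c\<^sup>2 * inverse (\<mu> n))"
      using pos[of n] by (simp add: d_def field_simps power2_eq_square)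
    then have "0 \<le> \<delta>\<^sup>2 - 4 * \<alpha> * c\<^sup>2 * inverse (\<mu> n)"
      using d_nonneg[OF elim] pos[of n] by (simp add: zero_le_mult_iff)
    then have S2: "(S n)\<^sup>2 = \<delta>\<^sup>2 - 4 * \<alpha> * c\<^sup>2 * inverse (\<mu> n)" "S n \<ge> 0"
      by (simp_all add: S_def)
    have "sqrt (d n) = \<mu> n * S n"
      using pos[of n] unfolding dS real_sqrt_mult S_def by simp
    have "(\<mu> n * S n - \<delta> * \<mu> n) * (S n + \<delta>) = \<mu> n * ((S n)\<^sup>2 - \<delta>\<^sup>2)"
      by (simp add: algebra_simps power2_eq_square)
    also have "\<dots> = - 4 * \<alpha> * c\<^sup>2"
      unfolding S2 using pos[of n] by (simp add: field_simps)
    finally have "- 2 * c\<^sup>2 * (2 * \<alpha>) = (- (\<delta> * \<mu> n) + \<mu> n * S n) * (S n + \<delta>)"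
      by (simp add: algebra_simps)
    moreover have nonzero: "S n + \<delta> \<noteq> 0" "2 * \<alpha> \<noteq> 0"
      using params S2(2) by auto
    ultimately have "- 2 * c\<^sup>2 / (S n + \<delta>) = (- (\<delta> * \<mu> n) + \<mu> n * S n) / (2 * \<alpha>)"
      by (simp only: frac_eq_eq[OF nonzero])
    then show ?case
      unfolding real0[OF elim] \<open>sqrt (d n) = \<mu> n * S n\<close> by simp
  qed
  ultimately have lim0: "l0 \<longlonglongrightarrow> complex_of_real (- (c\<^sup>2 / \<delta>))"
    by (rule Lim_transform_eventually)
  \<comment> \<open>Since \<open>csqrt\<close> has nonnegative real part, this lower bound for - Re
    (l1 n) holds for every n, whether or not the roots are real.\<close>
  have "filterlim (\<lambda>n. \<delta> / (2 * \<alpha>) * \<mu> n) at_top sequentially"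
    using params by (intro filterlim_tendsto_pos_mult_at_top[OF tendsto_const _ lim]) simp
  then have "filterlim (\<lambda>n. - Re (l1 n)) at_top sequentially"
  proof (rule filterlim_at_top_mono, intro always_eventually allI)
    fix n
    have "- Re (l1 n) = (\<delta> * \<mu> n + Re (csqrt (of_real (d n)))) / (2 * \<alpha>)"
      using Re_divide_of_real[of "- of_real (\<delta> * \<mu> n) - csqrt (of_real (d n))" "2 * \<alpha>"]
      by (simp add: l1_def add_divide_distrib diff_divide_distrib)
    moreover have "Re (csqrt (of_real (d n))) \<ge> 0"
      by (rule Re_csqrt)
    ultimately show "\<delta> / (2 * \<alpha>) * \<mu> n \<le> - Re (l1 n)"
      using params by (simp add: divide_right_mono)
  qed
  then have lim1: "filterlim (\<lambda>n. Re (l1 n)) at_bot sequentially"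
    by (simp add: filterlim_uminus_at_bot)
  show ?thesis
    by (rule that[OF roots Re_neg real lim0 lim1])
qed

theorem proposition2p3:
  fixes A :: "'h::{complex_inner, complete_space} \<rightharpoonup> 'h"
    and \<alpha> c \<delta> :: real
    and \<mu> :: "nat \<Rightarrow> real"
  assumes infinite_dim: "\<not> (\<exists>B::'h set. finite B \<and> module.span scaleC B = UNIV)"
    and separable: "separable_space (euclidean :: 'h topology)"
    and A: "self_adjoint A" "positive_op A" "has_compact_resolvent A"
    and eigenvalues: "point_spectrum A = range (\<lambda>n. complex_of_real (\<mu> n))"
    and mu_lim: "filterlim \<mu> at_top sequentially"
    and params: "\<alpha> > 0" "c > 0" "\<delta> > 0"
  shows
    "residual_spectrum (energy_space A) (energy_norm A) (damped_wave_op \<alpha> c \<delta> A) = {} \<and>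
     continuous_spectrum (energy_space A) (energy_norm A) (damped_wave_op \<alpha> c \<delta> A)
       = {complex_of_real (- (c\<^sup>2 / \<delta>))} \<and>
     point_spectrum (damped_wave_op \<alpha> c \<delta> A)
       = {z. \<exists>n. complex_of_real \<alpha> * z\<^sup>2 + complex_of_real (\<delta> * \<mu> n) * z
                + complex_of_real (c\<^sup>2 * \<mu> n) = 0} \<and>
     (\<exists>l0 l1 :: nat \<Rightarrow> complex.
        (\<forall>n. {z. complex_of_real \<alpha> * z\<^sup>2 + complex_of_real (\<delta> * \<mu> n) * z
                + complex_of_real (c\<^sup>2 * \<mu> n) = 0} = {l0 n, l1 n}) \<and>
        point_spectrum (damped_wave_op \<alpha> c \<delta> A) = range l0 \<union> range l1 \<and>
        (\<forall>n. Re (l0 n) < 0 \<and> Re (l1 n) < 0) \<and>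
        (\<forall>\<^sub>F n in sequentially. l0 n \<in> \<real> \<and> l1 n \<in> \<real>) \<and>
        l0 \<longlonglongrightarrow> complex_of_real (- (c\<^sup>2 / \<delta>)) \<and>
        filterlim (\<lambda>n. Re (l1 n)) at_bot sequentially)"
proof -
  obtain e s where e: "hilbert_basis e" and s: "\<And>n. s n > 0" "filterlim s at_top sequentially"
    and A_eq: "A = hilbert_basis.diag e s"
    by (rule ex_eigenbasis[OF infinite_dim A]) (rule that; blast)
  interpret damped_wave e s \<alpha> c \<delta>
    using e s params by (simp add: damped_wave_def damped_wave_axioms_def)
  have ranges: "range (\<lambda>n. complex_of_real (s n)) = range (\<lambda>n. complex_of_real (\<mu> n))"
    using eigenvalues unfolding A_eq point_spectrum_diag .
  \<comment> \<open>The orders and multiplicities of \<open>s\<close> and \<open>\<mu>\<close> may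
    differ, but equal ranges suffice to transfer positivity and the set of all roots.\<close>
  have range: "range s = range \<mu>"
    using arg_cong[OF ranges, of "image Re"] by (simp add: image_image)
  then have \<mu>_pos: "\<mu> n > 0" for n
    using s(1) by (metis rangeE rangeI)
  have point: "point_spectrum (damped_wave_op \<alpha> c \<delta> A)
       = {z. \<exists>n. complex_of_real \<alpha> * z\<^sup>2 + complex_of_real (\<delta> * \<mu> n) * z
                + complex_of_real (c\<^sup>2 * \<mu> n) = 0}"
  proof -
    \<comment> \<open>As a predicate of the eigenvalue alone, it makes the existential over n depend
      only on the range.\<close>
    define Q where "Q m z \<longleftrightarrow> complex_of_real \<alpha> * z\<^sup>2 + complex_of_real (\<delta> * m) * z
        + complex_of_real (c\<^sup>2 * m) = 0" for m z
    have "(\<exists>n. Q (s n) z) \<longleftrightarrow> (\<exists>n. Q (\<mu> n) z)" for z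
      using range by (metis rangeE rangeI)
    then show ?thesis
      unfolding A_eq point_spectrum_damped_wave q_def Q_def by blast
  qed
  obtain l0 l1 where roots: "\<And>n. {z. complex_of_real \<alpha> * z\<^sup>2 + complex_of_real (\<delta> * \<mu> n) * z
        + complex_of_real (c\<^sup>2 * \<mu> n) = 0} = {l0 n, l1 n}"
    and neg: "\<And>n. Re (l0 n) < 0" "\<And>n. Re (l1 n) < 0"
    and lims: "\<forall>\<^sub>F n in sequentially. l0 n \<in> \<real> \<and> l1 n \<in> \<real>"
    "l0 \<longlonglongrightarrow> complex_of_real (- (c\<^sup>2 / \<delta>))" "filterlim (\<lambda>n. Re (l1 n)) at_bot sequentially"
    by (rule damped_roots[OF params \<mu>_pos mu_lim]) (rule that; assumption?)
  have "point_spectrum (damped_wave_op \<alpha> c \<delta> A) = (\<Union>n. {l0 n, l1 n})"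
    unfolding point roots[symmetric] by blast
  also have "\<dots> = range l0 \<union> range l1"
    by auto
  finally have branches: "point_spectrum (damped_wave_op \<alpha> c \<delta> A) = range l0 \<union> range l1" .
  show ?thesis
    by (intro conjI residual_spectrum_damped_wave[folded A_eq]
        continuous_spectrum_damped_wave[folded A_eq] point,
        rule exI[of _ l0], rule exI[of _ l1], intro conjI allI roots branches neg lims)
qed

end
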